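(* Let $H$ be a Horn program (a finite set of definite clauses $A \leftarrow B_1,\dots,B_k$, $k\ge 0$, possibly with variables) and let $P$ be a predicate of $H$ such that every predicate of $H$ is reachable from $P$ in the predicate call graph of $H$. Assume that for every clause of $H$ there is some instance of its body that is true in the least Herbrand model of $H$. Then evaluation of a goal on predicate $P$ in $H$ under Subsumptive Tabling With Full Abstraction (STWFA) is equivalent to a bottom-up computation of the least model of $H$.
   Context: The predicate call graph of $H$ has the predicates of $H$ as nodes and an edge from $p$ to $q$ whenever $q$ occurs in the body of a clause of $H$ whose head has predicate $p$. STWFA evaluation (multiple-machine model). A global, monotonically growing table is maintained; each entry is a most-general goal $p(X_1,\dots,X_n)$ (distinct variables) together with an ordered list of answers (proved instances of it) and a set of machines suspended on it, each remembering how many answers it has already consumed. A machine state is a form $H_0 \leftarrow B_1,\dots,B_k$: the machine is about to call $B_1$, then $B_2,\dots,B_k$, then return $H_0$. Computation starts with one machine for the initial goal. When a machine calls a goal $B_1$ with predicate $p$: if the most-general goal $p(X_1,\dots,X_n)$ is not in the table, it is added with an empty answer list, a new machine is forked for each clause of $H$ with head predicate $p$ (to resolve the most-general goal against that clause), and the calling machine suspends on this entry; if the entry already exists, the calling machine just suspends on it. A machine with nothing left to call ($k=0$) adds its head instance to the end of the answer list of the corresponding table entry if it is not already there, and disappears; a machine that fails disappears. Whenever an entry has an answer not yet consumed by a suspended machine, that machine forks a copy which, if the answer unifies with its suspended goal $B_1$, applies the unifier and continues with $B_2,\dots,B_k$ (otherwise the copy disappears); the suspended machine remains and records the answer as consumed.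 Answers are returned in the order they were added. A scheduler chooses, at each step, which pending machine operation to perform. Bottom-up computation. For each clause of $H$ there is a rule process; there is a global set of proven facts, initially empty. Each rule process repeatedly finds instances of its clause all of whose body atoms are in the global fact set and adds the corresponding head atom to the set if not already present. Processes run, in any interleaving/scheduling order, until a fixpoint where no process can add a new fact; the resulting set is the least model of $H$. (Synchronizing in rounds using only facts from earlier rounds gives the usual iterative bottom-up algorithm.) "Equivalent" means that the STWFA machines forked for the clauses when a most-general goal is first called play the role of the rule processes, a machine returning a new answer corresponds to a rule process adding a new fact, and for a fixed scheduling order of STWFA there is a corresponding scheduling order of the bottom-up rule processes producing the same computation. *)

theory Defs
  imports Main "HOL-Library.Multiset"
begin

datatype 'f trm = Var nat | Fun 'f "'f trm list"

datatype ('p, 'f) atom = Atom (name: 'p) (args: "'f trm list")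

datatype ('p, 'f) clause = Clause (head: "('p, 'f) atom") (body: "('p, 'f) atom list")

text \<open>A predicate is a name together with its arity, and likewise for function symbols in
  a signature.\<close>

type_synonym 'p predicate = "'p \<times> nat"

definition pred :: "('p, 'f) atom \<Rightarrow> 'p predicate" where
  "pred A = (name A, length (args A))"

definition preds :: "('p, 'f) clause set \<Rightarrow> 'p predicate set" where
  "preds H = (\<Union>c\<in>H. insert (pred (head c)) (pred ` set (body c)))"

definition clauses_for :: "('p, 'f) clause set \<Rightarrow> 'p predicate \<Rightarrow> ('p, 'f) clause set" where
  "clauses_for H p = {c \<in> H. pred (head c) = p}"

definition call_graph :: "('p, 'f) clause set \<Rightarrow> ('p predicate \<times> 'p predicate) set" where
  "call_graph H = {(p, q). \<exists>c\<in>H. pred (head c) = p \<and> q \<in> pred ` set (body c)}"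

primrec funs_trm :: "'f trm \<Rightarrow> ('f \<times> nat) set" where
  "funs_trm (Var x) = {}"
| "funs_trm (Fun f ts) = insert (f, length ts) (\<Union> (set (map funs_trm ts)))"

definition funs_atom :: "('p, 'f) atom \<Rightarrow> ('f \<times> nat) set" where
  "funs_atom A = (\<Union>t\<in>set (args A). funs_trm t)"

definition funs_program :: "('p, 'f) clause set \<Rightarrow> ('f \<times> nat) set" where
  "funs_program H = (\<Union>c\<in>H. \<Union>A\<in>insert (head c) (set (body c)). funs_atom A)"

primrec vars_trm :: "'f trm \<Rightarrow> nat set" where
  "vars_trm (Var x) = {x}"
| "vars_trm (Fun f ts) = \<Union> (set (map vars_trm ts))"

definition vars_atom :: "('p, 'f) atom \<Rightarrow> nat set" where
  "vars_atom A = (\<Union>t\<in>set (args A). vars_trm t)"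

definition vars_clause :: "('p, 'f) clause \<Rightarrow> nat set" where
  "vars_clause c = (\<Union>A\<in>insert (head c) (set (body c)). vars_atom A)"


type_synonym 'f subst = "nat \<Rightarrow> 'f trm"

primrec subst_trm :: "'f subst \<Rightarrow> 'f trm \<Rightarrow> 'f trm" where
  "subst_trm \<sigma> (Var x) = \<sigma> x"
| "subst_trm \<sigma> (Fun f ts) = Fun f (map (subst_trm \<sigma>) ts)"

definition subst_atom :: "'f subst \<Rightarrow> ('p, 'f) atom \<Rightarrow> ('p, 'f) atom" where
  "subst_atom \<sigma> A = Atom (name A) (map (subst_trm \<sigma>) (args A))"

definition subst_clause :: "'f subst \<Rightarrow> ('p, 'f) clause \<Rightarrow> ('p, 'f) clause" where
  "subst_clause \<sigma> c = Clause (subst_atom \<sigma> (head c)) (map (subst_atom \<sigma>) (body c))"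

definition renaming :: "'f subst \<Rightarrow> bool" where
  "renaming \<rho> \<longleftrightarrow> (\<exists>\<pi>. bij \<pi> \<and> \<rho> = Var \<circ> \<pi>)"

definition variant :: "('p, 'f) atom \<Rightarrow> ('p, 'f) atom \<Rightarrow> bool" where
  "variant A B \<longleftrightarrow> (\<exists>\<rho>. renaming \<rho> \<and> B = subst_atom \<rho> A)"

definition instance_of :: "('p, 'f) atom \<Rightarrow> ('p, 'f) atom \<Rightarrow> bool" where
  "instance_of A B \<longleftrightarrow> (\<exists>\<sigma>. A = subst_atom \<sigma> B)"

definition clause_instance_of :: "('p, 'f) clause \<Rightarrow> ('p, 'f) clause \<Rightarrow> bool" where
  "clause_instance_of c d \<longleftrightarrow> (\<exists>\<sigma>. c = subst_clause \<sigma> d)"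

definition unifier :: "'f subst \<Rightarrow> ('p, 'f) atom \<Rightarrow> ('p, 'f) atom \<Rightarrow> bool" where
  "unifier \<sigma> A B \<longleftrightarrow> subst_atom \<sigma> A = subst_atom \<sigma> B"

definition mgu :: "'f subst \<Rightarrow> ('p, 'f) atom \<Rightarrow> ('p, 'f) atom \<Rightarrow> bool" where
  "mgu \<sigma> A B \<longleftrightarrow> unifier \<sigma> A B \<and>
     (\<forall>\<tau>. unifier \<tau> A B \<longrightarrow> (\<exists>\<delta>. \<forall>x. \<tau> x = subst_trm \<delta> (\<sigma> x)))"


section \<open>The least Herbrand model\<close>

inductive_set herbrand_universe :: "('f \<times> nat) set \<Rightarrow> 'f trm set" for F where
  "(f, length ts) \<in> F \<Longrightarrow> \<forall>t\<in>set ts. t \<in> herbrand_universe F \<Longrightarrow>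
     Fun f ts \<in> herbrand_universe F"

definition herbrand_base :: "('f \<times> nat) set \<Rightarrow> ('p, 'f) atom set" where
  "herbrand_base F = {A. \<forall>t\<in>set (args A). t \<in> herbrand_universe F}"

definition ground_subst :: "('f \<times> nat) set \<Rightarrow> 'f subst \<Rightarrow> bool" where
  "ground_subst F \<gamma> \<longleftrightarrow> (\<forall>x. \<gamma> x \<in> herbrand_universe F)"

definition herbrand_model ::
  "('f \<times> nat) set \<Rightarrow> ('p, 'f) clause set \<Rightarrow> ('p, 'f) atom set \<Rightarrow> bool" where
  "herbrand_model F H I \<longleftrightarrow> I \<subseteq> herbrand_base F \<and>
     (\<forall>c\<in>H. \<forall>\<gamma>. ground_subst F \<gamma> \<longrightarrow>
        subst_atom \<gamma> ` set (body c) \<subseteq> I \<longrightarrow> subst_atom \<gamma> (head c) \<in> I)"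

definition least_herbrand_model ::
  "('f \<times> nat) set \<Rightarrow> ('p, 'f) clause set \<Rightarrow> ('p, 'f) atom set" where
  "least_herbrand_model F H = \<Inter> {I. herbrand_model F H I}"

text \<open>An atom with variables stands for all its ground instances.\<close>

definition ground_instances ::
  "('f \<times> nat) set \<Rightarrow> ('p, 'f) atom set \<Rightarrow> ('p, 'f) atom set" where
  "ground_instances F S = {A \<in> herbrand_base F. \<exists>B\<in>S. instance_of A B}"


section \<open>Subsumptive tabling with full abstraction\<close>

text \<open>The origin of a machine is the clause for which it, or the machine it was copied from,
  was forked; it is \<open>None\<close> for the machine of the initial goal and its copies.\<close>

datatype ('p, 'f) machine =
  Machine (origin: "('p, 'f) clause option") (form: "('p, 'f) clause")

text \<open>A suspended machine is paired with the number of answers it has consumed.\<close>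

record ('p, 'f) entry =
  answers :: "('p, 'f) atom list"
  suspended :: "(('p, 'f) machine \<times> nat) multiset"

text \<open>The table is indexed by predicates, which determine the most-general goals. Since no table
  entry belongs to the initial goal itself, its answers are collected in \<open>results\<close>.\<close>

record ('p, 'f) state =
  table :: "'p predicate \<Rightarrow> ('p, 'f) entry option"
  running :: "('p, 'f) machine multiset"
  results :: "('p, 'f) atom list"

definition initial_state :: "('p, 'f) atom \<Rightarrow> ('p, 'f) state" where
  "initial_state G =
     \<lparr>table = (\<lambda>_. None), running = {#Machine None (Clause G [G])#}, results = []\<rparr>"

definition most_general_goal :: "'p predicate \<Rightarrow> ('p, 'f) atom" where
  "most_general_goal p = Atom (fst p) (map Var [0..<snd p])"

text \<open>Resolving the most-general goal of \<open>p\<close> against the clause \<open>c\<close>.\<close>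

definition rule_machine ::
  "'p predicate \<Rightarrow> ('p, 'f) clause \<Rightarrow> ('p, 'f) machine \<Rightarrow> bool" where
  "rule_machine p c m \<longleftrightarrow> (\<exists>\<rho> \<sigma>. renaming \<rho> \<and>
     vars_clause (subst_clause \<rho> c) \<inter> vars_atom (most_general_goal p :: ('p, 'f) atom) = {} \<and>
     mgu \<sigma> (most_general_goal p) (subst_atom \<rho> (head c)) \<and>
     m = Machine (Some c)
       (Clause (subst_atom \<sigma> (most_general_goal p))
         (map (subst_atom \<sigma>) (body (subst_clause \<rho> c)))))"

definition renamed_apart ::
  "('p, 'f) machine \<Rightarrow> ('p, 'f) atom \<Rightarrow> ('p, 'f) atom \<Rightarrow> bool" where
  "renamed_apart m A A' \<longleftrightarrow> variant A A' \<and> vars_clause (form m) \<inter> vars_atom A' = {}"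

definition unifies_with_answer :: "('p, 'f) machine \<Rightarrow> ('p, 'f) atom \<Rightarrow> bool" where
  "unifies_with_answer m A \<longleftrightarrow>
     (\<exists>A' \<sigma>. renamed_apart m A A' \<and> unifier \<sigma> (hd (body (form m))) A')"

definition resumes_with ::
  "('p, 'f) machine \<Rightarrow> ('p, 'f) atom \<Rightarrow> ('p, 'f) machine \<Rightarrow> bool" where
  "resumes_with m A m' \<longleftrightarrow> (\<exists>A' \<sigma>. renamed_apart m A A' \<and>
     mgu \<sigma> (hd (body (form m))) A' \<and>
     m' = Machine (origin m)
       (Clause (subst_atom \<sigma> (head (form m))) (map (subst_atom \<sigma>) (tl (body (form m))))))"

definition add_answer :: "('p, 'f) atom \<Rightarrow> ('p, 'f) atom list \<Rightarrow> ('p, 'f) atom list" where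
  "add_answer A As = (if \<exists>B\<in>set As. variant A B then As else As @ [A])"

datatype ('p, 'f) operation =
  Call "('p, 'f) machine"
| Return "('p, 'f) machine"
| Consume "'p predicate" "('p, 'f) machine" nat

inductive step ::
  "('p, 'f) clause set \<Rightarrow> ('p, 'f) operation \<Rightarrow> ('p, 'f) state \<Rightarrow> ('p, 'f) state \<Rightarrow> bool"
  for H where
  call_new:
    "m \<in># running s \<Longrightarrow> body (form m) = B # Bs \<Longrightarrow> table s (pred B) = None \<Longrightarrow>
     \<forall>c \<in> clauses_for H (pred B). rule_machine (pred B) c (fork c) \<Longrightarrow>
     step H (Call m) s
       (s\<lparr>table := (table s)(pred B \<mapsto> \<lparr>answers = [], suspended = {#(m, 0)#}\<rparr>),
          running := running s - {#m#} + image_mset fork (mset_set (clauses_for H (pred B)))\<rparr>)"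
| call_old:
    "m \<in># running s \<Longrightarrow> body (form m) = B # Bs \<Longrightarrow> table s (pred B) = Some e \<Longrightarrow>
     step H (Call m) s
       (s\<lparr>table := (table s)(pred B \<mapsto> e\<lparr>suspended := add_mset (m, 0) (suspended e)\<rparr>),
          running := running s - {#m#}\<rparr>)"
| return_answer:
    "m \<in># running s \<Longrightarrow> origin m = Some c \<Longrightarrow> form m = Clause A [] \<Longrightarrow>
     table s (pred A) = Some e \<Longrightarrow>
     step H (Return m) s
       (s\<lparr>table := (table s)(pred A \<mapsto> e\<lparr>answers := add_answer A (answers e)\<rparr>),
          running := running s - {#m#}\<rparr>)"
| return_result:
    "m \<in># running s \<Longrightarrow> origin m = None \<Longrightarrow> form m = Clause A [] \<Longrightarrow>
     step H (Return m) s
       (s\<lparr>running := running s - {#m#}, results := add_answer A (results s)\<rparr>)"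
| consume_success:
    "table s p = Some e \<Longrightarrow> (m, i) \<in># suspended e \<Longrightarrow> i < length (answers e) \<Longrightarrow>
     resumes_with m (answers e ! i) m' \<Longrightarrow>
     step H (Consume p m i) s
       (s\<lparr>table := (table s)(p \<mapsto>
            e\<lparr>suspended := add_mset (m, Suc i) (suspended e - {#(m, i)#})\<rparr>),
          running := add_mset m' (running s)\<rparr>)"
| consume_failure:
    "table s p = Some e \<Longrightarrow> (m, i) \<in># suspended e \<Longrightarrow> i < length (answers e) \<Longrightarrow>
     \<not> unifies_with_answer m (answers e ! i) \<Longrightarrow>
     step H (Consume p m i) s
       (s\<lparr>table := (table s)(p \<mapsto>
            e\<lparr>suspended := add_mset (m, Suc i) (suspended e - {#(m, i)#})\<rparr>)\<rparr>)"

text \<open>A run is given by its states and by the choices of the scheduler. It goes on as long as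
  some operation is pending; a finite evaluation is continued by idling forever in its final
  state. This way finite and infinite evaluations are both infinite sequences.\<close>

definition stwfa_run ::
  "('p, 'f) clause set \<Rightarrow> ('p, 'f) atom \<Rightarrow> (nat \<Rightarrow> ('p, 'f) state) \<Rightarrow>
   (nat \<Rightarrow> ('p, 'f) operation option) \<Rightarrow> bool" where
  "stwfa_run H G s sched \<longleftrightarrow> s 0 = initial_state G \<and>
     (\<forall>n. case sched n of
        None \<Rightarrow> (\<nexists>oper t. step H oper (s n) t) \<and> s (Suc n) = s n
      | Some oper \<Rightarrow> step H oper (s n) (s (Suc n)))"

text \<open>No pending operation is ignored forever. Every terminating run is fair.\<close>

definition fair ::
  "('p, 'f) clause set \<Rightarrow> (nat \<Rightarrow> ('p, 'f) state) \<Rightarrow>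
   (nat \<Rightarrow> ('p, 'f) operation option) \<Rightarrow> bool" where
  "fair H s sched \<longleftrightarrow>
     (\<forall>oper n. (\<forall>k\<ge>n. \<exists>t. step H oper (s k) t) \<longrightarrow> (\<exists>k\<ge>n. sched k = Some oper))"

definition table_answers :: "('p, 'f) state \<Rightarrow> ('p, 'f) atom set" where
  "table_answers s = {A. \<exists>p e. table s p = Some e \<and> A \<in> set (answers e)}"

text \<open>At time \<open>n\<close> the most-general goal for the head of \<open>c\<close> is called for the first time and
  exactly one machine is forked for \<open>c\<close>.\<close>

definition forks_rule_machine ::
  "(nat \<Rightarrow> ('p, 'f) state) \<Rightarrow> nat \<Rightarrow> ('p, 'f) clause \<Rightarrow> bool" where
  "forks_rule_machine s n c \<longleftrightarrow> table (s n) (pred (head c)) = None \<and>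
     size {#m \<in># running (s (Suc n)). origin m = Some c#} = 1"

definition returns_new_answer ::
  "(nat \<Rightarrow> ('p, 'f) state) \<Rightarrow> (nat \<Rightarrow> ('p, 'f) operation option) \<Rightarrow> nat \<Rightarrow>
   ('p, 'f) clause \<Rightarrow> ('p, 'f) atom \<Rightarrow> bool" where
  "returns_new_answer s sched n c A \<longleftrightarrow>
     (\<exists>m. sched n = Some (Return m) \<and> origin m = Some c \<and> head (form m) = A \<and>
        \<not> (\<exists>B\<in>table_answers (s n). variant A B))"


section \<open>Bottom-up computation\<close>

text \<open>As programs need not be range-restricted, facts may contain variables. A body atom holds
  if it is an instance of a fact; for ground facts this means that it is a fact. Among the
  clause instances whose body atoms hold because of given facts, a rule process finds the most
  general one. Facts are identified up to renaming of variables.\<close>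

definition supported ::
  "('p, 'f) clause \<Rightarrow> ('p, 'f) atom list \<Rightarrow> 'f subst \<Rightarrow> bool" where
  "supported c As \<sigma> \<longleftrightarrow> list_all2 instance_of (body (subst_clause \<sigma> c)) As"

definition most_general_supported ::
  "('p, 'f) clause \<Rightarrow> ('p, 'f) atom list \<Rightarrow> 'f subst \<Rightarrow> bool" where
  "most_general_supported c As \<sigma> \<longleftrightarrow> supported c As \<sigma> \<and>
     (\<forall>\<tau>. supported c As \<tau> \<longrightarrow> clause_instance_of (subst_clause \<tau> c) (subst_clause \<sigma> c))"

definition adds_fact ::
  "('p, 'f) clause \<Rightarrow> ('p, 'f) atom set \<Rightarrow> ('p, 'f) atom \<Rightarrow> bool" where
  "adds_fact c S A \<longleftrightarrow>
     (\<exists>As \<sigma>. set As \<subseteq> S \<and> most_general_supported c As \<sigma> \<and> A = subst_atom \<sigma> (head c)) \<and>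
     \<not> (\<exists>B\<in>S. variant A B)"

text \<open>The schedule tells which rule process adds a fact at time \<open>n\<close>; \<open>None\<close> means that none
  does.\<close>

definition bottom_up_run ::
  "('p, 'f) clause set \<Rightarrow> (nat \<Rightarrow> ('p, 'f) atom set) \<Rightarrow>
   (nat \<Rightarrow> ('p, 'f) clause option) \<Rightarrow> bool" where
  "bottom_up_run H S r \<longleftrightarrow> S 0 = {} \<and>
     (\<forall>n. case r n of
        None \<Rightarrow> S (Suc n) = S n
      | Some c \<Rightarrow> c \<in> H \<and> (\<exists>A. adds_fact c (S n) A \<and> S (Suc n) = insert A (S n)))"

definition bottom_up_fixpoint ::
  "('p, 'f) clause set \<Rightarrow> ('p, 'f) atom set \<Rightarrow> bool" where
  "bottom_up_fixpoint H S \<longleftrightarrow> (\<forall>c\<in>H. \<nexists>A. adds_fact c S A)"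

text \<open>The same computation on ground facts. One fact with variables amounts to many ground
  facts, so at each time the scheduled rule process may add any number of them, each one
  derived from the ground facts present before.\<close>

definition adds_ground_fact ::
  "('f \<times> nat) set \<Rightarrow> ('p, 'f) clause \<Rightarrow> ('p, 'f) atom set \<Rightarrow> ('p, 'f) atom \<Rightarrow> bool" where
  "adds_ground_fact F c S A \<longleftrightarrow>
     (\<exists>\<gamma>. ground_subst F \<gamma> \<and> subst_atom \<gamma> ` set (body c) \<subseteq> S \<and> A = subst_atom \<gamma> (head c)) \<and>
     A \<notin> S"

definition ground_bottom_up_run ::
  "('f \<times> nat) set \<Rightarrow> ('p, 'f) clause set \<Rightarrow> (nat \<Rightarrow> ('p, 'f) atom set) \<Rightarrow>
   (nat \<Rightarrow> ('p, 'f) clause option) \<Rightarrow> bool" where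
  "ground_bottom_up_run F H S r \<longleftrightarrow> S 0 = {} \<and>
     (\<forall>n. case r n of
        None \<Rightarrow> S (Suc n) = S n
      | Some c \<Rightarrow> c \<in> H \<and> S n \<subseteq> S (Suc n) \<and>
          (\<forall>A \<in> S (Suc n) - S n. adds_ground_fact F c (S n) A))"

end

theory Submission
  imports Defs
begin

text \<open>A machine forked for a clause \<open>c\<close> that has consumed the answers \<open>As\<close> carries the most general
  instance of \<open>c\<close> whose first body atoms are instances of \<open>As\<close>. This is an invariant of the
  evaluation, so every answer it returns is a fact that the rule process of \<open>c\<close> may add.

  Conversely, in a fair evaluation a machine runs through every list of answers that matches the
  body of its clause. By induction over the least model, every true atom whose predicate is called
  is an instance of an answer. Since every body has a true instance, some machine therefore gets to
  call each body atom, so being called is inherited along the call graph and all predicates are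
  called. The answers are then closed under all rule processes.\<close>


section \<open>Terms, substitutions and renamings\<close>

text \<open>Answers and calls depend on each other: a body atom is called only after the atoms to
  its left have been answered, and it is answered only if its predicate is called. The circle is
  broken by first proving completeness relative to the called predicates, with no constraint on the
  others, and only then letting true bodies spread the calls. Unifiers are not unique and answers
  are kept up to renaming, so answers and facts are compared through \<open>variant\<close>. Mutual
  instances are variants, which makes every choice of unifier or renaming immaterial. Both
  computations share one time axis: a rule process is scheduled exactly when a machine returns a new
  answer, and at all other times the bottom-up run idles. This correspondence is a safety property;
  reaching the fixpoint is a liveness property, drawn from fairness and valid for infinite runs as
  well. Facts may contain variables and unifiers may use symbols outside \<open>F\<close>. The
  constant in \<open>F\<close> is the default to which variables and foreign subterms are cut when
  passing to ground facts.\<close>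

lemma subst_trm_comp:
  "subst_trm \<sigma> (subst_trm \<tau> t) = subst_trm (\<lambda>x. subst_trm \<sigma> (\<tau> x)) t"
  by (induction t) auto

lemma subst_trm_cong: "(\<And>x. x \<in> vars_trm t \<Longrightarrow> \<sigma> x = \<tau> x) \<Longrightarrow> subst_trm \<sigma> t = subst_trm \<tau> t"
  by (induction t) auto

lemma subst_trm_eqD: "subst_trm \<sigma> t = subst_trm \<tau> t \<Longrightarrow> x \<in> vars_trm t \<Longrightarrow> \<sigma> x = \<tau> x"
  by (induction t) auto

lemma subst_trm_Var [simp]: "subst_trm Var t = t"
  by (induction t) (auto intro: map_idI)

lemma vars_subst_trm: "vars_trm (subst_trm \<sigma> t) = (\<Union>x\<in>vars_trm t. vars_trm (\<sigma> x))"
  by (induction t) auto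

lemma finite_vars_trm [simp]: "finite (vars_trm t)"
  by (induction t) auto

lemma funs_subst_trm: "funs_trm t \<subseteq> funs_trm (subst_trm \<sigma> t)"
  by (induction t) auto

text \<open>The occurs check in quantitative form: a variable strictly inside \<open>t\<close> has a
  strictly smaller image than \<open>t\<close>. In a system known to be solvable, eliminating a
  variable therefore never meets a cyclic equation.\<close>

lemma size_subst_trm_var: "x \<in> vars_trm t \<Longrightarrow> t \<noteq> Var x \<Longrightarrow> size (\<sigma> x) < size (subst_trm \<sigma> t)"
proof (induction t)
  case (Fun f ts)
  then obtain t where t: "t \<in> set ts" "x \<in> vars_trm t"
    by auto
  have "size (\<sigma> x) \<le> size (subst_trm \<sigma> t)"
    using Fun.IH[OF t] by (cases "t = Var x") auto
  also have "\<dots> \<le> size_list size (map (subst_trm \<sigma>) ts)"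
    using t(1) by (intro size_list_estimation') auto
  finally show ?case
    by simp
qed auto

lemma subst_atom_simps [simp]:
  "name (subst_atom \<sigma> A) = name A"
  "args (subst_atom \<sigma> A) = map (subst_trm \<sigma>) (args A)"
  "pred (subst_atom \<sigma> A) = pred A"
  by (simp_all add: subst_atom_def pred_def)

lemma subst_atom_comp:
  "subst_atom \<sigma> (subst_atom \<tau> A) = subst_atom (\<lambda>x. subst_trm \<sigma> (\<tau> x)) A"
  by (simp add: subst_atom_def subst_trm_comp)

lemma subst_atom_Var [simp]: "subst_atom Var A = A"
  by (cases A) (simp add: subst_atom_def map_idI)

lemma subst_atom_cong: "(\<And>x. x \<in> vars_atom A \<Longrightarrow> \<sigma> x = \<tau> x) \<Longrightarrow> subst_atom \<sigma> A = subst_atom \<tau> A"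
  by (auto simp: subst_atom_def vars_atom_def intro!: subst_trm_cong)

lemma subst_atom_eqD: "subst_atom \<sigma> A = subst_atom \<tau> A \<Longrightarrow> x \<in> vars_atom A \<Longrightarrow> \<sigma> x = \<tau> x"
  by (auto simp: subst_atom_def vars_atom_def dest: subst_trm_eqD)

lemma vars_subst_atom: "vars_atom (subst_atom \<sigma> A) = (\<Union>x\<in>vars_atom A. vars_trm (\<sigma> x))"
  by (auto simp: vars_atom_def vars_subst_trm)

lemma finite_vars_atom [simp]: "finite (vars_atom A)"
  by (simp add: vars_atom_def)

lemma finite_vars_clause [simp]: "finite (vars_clause c)"
  by (simp add: vars_clause_def)

lemma subst_clause_simps [simp]:
  "head (subst_clause \<sigma> c) = subst_atom \<sigma> (head c)"
  "body (subst_clause \<sigma> c) = map (subst_atom \<sigma>) (body c)"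
  by (simp_all add: subst_clause_def)

lemma vars_clause_head: "x \<in> vars_atom (head c) \<Longrightarrow> x \<in> vars_clause c"
  and vars_clause_body: "B \<in> set (body c) \<Longrightarrow> x \<in> vars_atom B \<Longrightarrow> x \<in> vars_clause c"
  by (auto simp: vars_clause_def)

lemma vars_subst_clause:
  "vars_clause (subst_clause \<sigma> c) = (\<Union>x\<in>vars_clause c. vars_trm (\<sigma> x))"
  by (auto simp: vars_clause_def vars_subst_atom)

section \<open>Instances, variants and fresh renamings\<close>

lemma instance_of_subst: "instance_of A B \<Longrightarrow> instance_of (subst_atom \<sigma> A) B"
  unfolding instance_of_def by (metis subst_atom_comp)

lemma instance_of_trans: "instance_of A B \<Longrightarrow> instance_of B C \<Longrightarrow> instance_of A C"
  unfolding instance_of_def by (metis subst_atom_comp)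

lemma pred_instance_of: "instance_of A B \<Longrightarrow> pred A = pred B"
  by (auto simp: instance_of_def)

lemma variant_trans:
  assumes "variant A B" "variant B C"
  shows "variant A C"
proof -
  from assms obtain \<pi> \<pi>' where "bij \<pi>" "B = subst_atom (Var \<circ> \<pi>) A" "bij \<pi>'" "C = subst_atom (Var \<circ> \<pi>') B"
    by (auto simp: variant_def renaming_def)
  then have "bij (\<pi>' \<circ> \<pi>)" "C = subst_atom (Var \<circ> (\<pi>' \<circ> \<pi>)) A"
    by (auto simp: subst_atom_comp o_def intro: bij_comp[unfolded o_def])
  then show ?thesis
    unfolding variant_def renaming_def by blast
qed

lemma variant_sym:
  assumes "variant A B"
  shows "variant B A"
proof -
  from assms obtain \<pi> where \<pi>: "bij \<pi>" "B = subst_atom (Var \<circ> \<pi>) A"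
    by (auto simp: variant_def renaming_def)
  then have "bij (inv \<pi>)" "A = subst_atom (Var \<circ> inv \<pi>) B"
    by (auto simp: subst_atom_comp o_def bij_imp_bij_inv bij_is_inj)
  then show ?thesis
    unfolding variant_def renaming_def by blast
qed

lemma variant_imp_instance_of: "variant A B \<Longrightarrow> instance_of A B"
  using variant_sym by (auto simp: variant_def instance_of_def)

lemma pred_variant: "variant A B \<Longrightarrow> pred A = pred B"
  using variant_imp_instance_of pred_instance_of by blast

text \<open>\<open>renaming\<close> asks for a permutation of all variables, while renamings arise
  as injections on finitely many. As \<open>X\<close> and its image have equal size, what each of
  them lacks in their union can be matched up; everything else stays fixed.\<close>

lemma bij_extends_inj_on:
  fixes f :: "'a \<Rightarrow> 'a"
  assumes "inj_on f X" "finite X"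
  obtains \<pi> where "bij \<pi>" "\<And>x. x \<in> X \<Longrightarrow> \<pi> x = f x"
proof -
  define U where "U = X \<union> f ` X"
  have "card (U - X) = card (U - f ` X)"
    using assms by (simp add: U_def card_Diff_subset card_image)
  then obtain g where g: "bij_betw g (U - X) (U - f ` X)"
    using assms by (metis U_def finite_Diff finite_UnI finite_imageI finite_same_card_bij)
  define \<pi> where "\<pi> x = (if x \<in> X then f x else if x \<in> U then g x else x)" for x
  have "bij_betw \<pi> X (f ` X)"
    using assms by (auto simp: \<pi>_def bij_betw_def inj_on_def)
  moreover have "bij_betw \<pi> (U - X) (U - f ` X)"
    using g by (rule bij_betw_cong[THEN iffD1, rotated]) (auto simp: \<pi>_def)
  moreover have "bij_betw \<pi> (- U) (- U)"
    by (rule bij_betw_cong[THEN iffD1, OF _ bij_betw_id]) (auto simp: \<pi>_def U_def)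
  ultimately have "bij_betw \<pi> ((X \<union> (U - X)) \<union> - U) ((f ` X \<union> (U - f ` X)) \<union> - U)"
    by (intro bij_betw_combine) (auto simp: U_def)
  moreover have "(X \<union> (U - X)) \<union> - U = UNIV" "(f ` X \<union> (U - f ` X)) \<union> - U = UNIV"
    by (auto simp: U_def)
  ultimately have "bij \<pi>"
    by simp
  then show ?thesis
    using that by (simp add: \<pi>_def)
qed

text \<open>Substituting there and back is the identity on the variables of \<open>A\<close>. Hence
  \<open>\<epsilon>\<close> sends them injectively to variables and extends to a
  permutation.\<close>

lemma instance_of_antisym:
  assumes "instance_of A B" "instance_of B A"
  shows "variant A B"
proof -
  obtain \<delta> \<epsilon> where \<delta>: "A = subst_atom \<delta> B" and \<epsilon>: "B = subst_atom \<epsilon> A"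
    using assms by (auto simp: instance_of_def)
  have inv: "subst_trm \<delta> (\<epsilon> x) = Var x" if "x \<in> vars_atom A" for x
  proof (rule subst_atom_eqD[OF _ that])
    show "subst_atom (\<lambda>x. subst_trm \<delta> (\<epsilon> x)) A = subst_atom Var A"
      by (metis \<delta> \<epsilon> subst_atom_comp subst_atom_Var)
  qed
  have "\<exists>y. \<epsilon> x = Var y" if "x \<in> vars_atom A" for x
    using inv[OF that] by (cases "\<epsilon> x") auto
  then obtain f where f: "\<And>x. x \<in> vars_atom A \<Longrightarrow> \<epsilon> x = Var (f x)"
    by metis
  have "inj_on f (vars_atom A)"
    using inv by (intro inj_onI) (metis f trm.inject(1))
  then obtain \<pi> where \<pi>: "bij \<pi>" "\<And>x. x \<in> vars_atom A \<Longrightarrow> \<pi> x = f x"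
    using bij_extends_inj_on finite_vars_atom by metis
  have "B = subst_atom (Var \<circ> \<pi>) A"
    using f \<pi>(2) by (subst \<epsilon>) (auto intro: subst_atom_cong)
  with \<pi>(1) show ?thesis
    by (auto simp: variant_def renaming_def)
qed

lemma fresh_renaming:
  fixes V W :: "nat set"
  assumes "finite V" "finite W"
  obtains \<pi> where "bij \<pi>" "\<pi> ` W \<inter> V = {}"
proof -
  obtain N where N: "\<And>v. v \<in> V \<union> W \<Longrightarrow> v < N"
    using assms by (metis finite_UnI finite_nat_set_iff_bounded)
  have "inj_on (\<lambda>v. v + N) W"
    by simp
  then obtain \<pi> where \<pi>: "bij \<pi>" "\<And>v. v \<in> W \<Longrightarrow> \<pi> v = v + N"
    using bij_extends_inj_on assms(2) by metis
  moreover have "\<pi> ` W \<inter> V = {}"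
    using \<pi>(2) N by fastforce
  ultimately show ?thesis
    using that by blast
qed

lemma fresh_variant:
  assumes "finite V"
  obtains A' where "variant A A'" "V \<inter> vars_atom A' = {}"
proof -
  obtain \<pi> where \<pi>: "bij \<pi>" "\<pi> ` vars_atom A \<inter> V = {}"
    using fresh_renaming[OF assms finite_vars_atom] .
  then have "variant A (subst_atom (Var \<circ> \<pi>) A)" "V \<inter> vars_atom (subst_atom (Var \<circ> \<pi>) A) = {}"
    by (auto simp: variant_def renaming_def vars_subst_atom)
  then show ?thesis
    using that by blast
qed


section \<open>Existence of most general unifiers\<close>

definition solves :: "'f subst \<Rightarrow> ('f trm \<times> 'f trm) list \<Rightarrow> bool" where
  "solves \<sigma> E \<longleftrightarrow> (\<forall>(s, t)\<in>set E. subst_trm \<sigma> s = subst_trm \<sigma> t)"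

definition most_general_solution :: "'f subst \<Rightarrow> ('f trm \<times> 'f trm) list \<Rightarrow> bool" where
  "most_general_solution \<sigma> E \<longleftrightarrow> solves \<sigma> E \<and>
     (\<forall>\<tau>. solves \<tau> E \<longrightarrow> (\<exists>\<delta>. \<forall>x. \<tau> x = subst_trm \<delta> (\<sigma> x)))"

lemma solves_simps [simp]:
  "solves \<sigma> []"
  "solves \<sigma> ((s, t) # E) \<longleftrightarrow> subst_trm \<sigma> s = subst_trm \<sigma> t \<and> solves \<sigma> E"
  "solves \<sigma> (E @ E') \<longleftrightarrow> solves \<sigma> E \<and> solves \<sigma> E'"
  by (auto simp: solves_def)

lemma solves_zip:
  "length ss = length ts \<Longrightarrow>
     solves \<sigma> (zip ss ts) \<longleftrightarrow> map (subst_trm \<sigma>) ss = map (subst_trm \<sigma>) ts"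
  by (induction ss ts rule: list_induct2) auto

abbreviation eliminate ::
  "nat \<Rightarrow> 'f trm \<Rightarrow> ('f trm \<times> 'f trm) list \<Rightarrow> ('f trm \<times> 'f trm) list" where
  "eliminate x t \<equiv> map (map_prod (subst_trm (Var(x := t))) (subst_trm (Var(x := t))))"

lemma subst_eliminated_var:
  assumes "\<tau> x = subst_trm \<tau> t"
  shows "subst_trm \<tau> (subst_trm (Var(x := t)) u) = subst_trm \<tau> u"
  using assms by (auto simp: subst_trm_comp intro: subst_trm_cong)

lemma solves_eliminated_var:
  assumes "\<tau> x = subst_trm \<tau> t"
  shows "solves \<tau> (eliminate x t E) \<longleftrightarrow> solves \<tau> E"
  using subst_eliminated_var[of \<tau>, OF assms] by (induction E) auto

text \<open>The solution of the reduced system is composed with the binding \<open>x := t\<close>.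
  As \<open>x\<close> does not occur in \<open>t\<close>, the binding leaves \<open>t\<close>
  unchanged, so the composite also solves the removed equation. It is most general because every
  solution of the full system equates \<open>x\<close> with \<open>t\<close> and thus absorbs the
  binding.\<close>

lemma most_general_solution_eliminate:
  assumes "x \<notin> vars_trm t"
    and "most_general_solution \<sigma> (eliminate x t E)"
  shows "\<exists>\<sigma>'. most_general_solution \<sigma>' ((Var x, t) # E)"
proof -
  let ?e = "Var(x := t)" and ?E = "eliminate x t E"
  define \<sigma>' where "\<sigma>' y = subst_trm \<sigma> (?e y)" for y
  have "subst_trm ?e t = t"
    using assms(1) by (metis fun_upd_apply subst_trm_Var subst_trm_cong)
  then have x: "\<sigma>' x = subst_trm \<sigma>' t"
    unfolding \<sigma>'_def subst_trm_comp[symmetric] by simp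
  have "solves \<sigma>' E"
    using assms(2) unfolding most_general_solution_def solves_def \<sigma>'_def subst_trm_comp[symmetric]
    by force
  moreover have "\<exists>\<delta>. \<forall>y. \<tau> y = subst_trm \<delta> (\<sigma>' y)" if "solves \<tau> ((Var x, t) # E)" for \<tau>
  proof -
    have \<tau>: "\<tau> x = subst_trm \<tau> t" "solves \<tau> ?E"
      using that solves_eliminated_var by fastforce+
    then obtain \<delta> where \<delta>: "\<And>y. \<tau> y = subst_trm \<delta> (\<sigma> y)"
      using assms(2) unfolding most_general_solution_def by blast
    have "\<tau> y = subst_trm \<delta> (\<sigma>' y)" for y
      using \<tau>(1) by (simp add: \<sigma>'_def subst_trm_comp \<delta>[symmetric])
    then show ?thesis
      by blast
  qed
  ultimately show ?thesis
    using x unfolding most_general_solution_def by auto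
qed

text \<open>Every step of the unification algorithm decreases the total size of the left-hand sides
  after applying the given solution, so no separate count of the variables is needed.\<close>

lemma most_general_solution_exists:
  assumes "solves \<tau> E"
  shows "\<exists>\<sigma>. most_general_solution \<sigma> E"
  using assms
proof (induction "sum_list (map (\<lambda>(s, t). Suc (size (subst_trm \<tau> s))) E)" arbitrary: E rule: less_induct)
  case less
  \<comment> \<open>Turning an equation around leaves the measure unchanged, so the induction
    hypothesis would not apply to the turned system. Both orientations are therefore handled by one
    claim.\<close>
  have eliminable: "\<exists>\<sigma>. most_general_solution \<sigma> ((Var x, t) # E')"
    if E: "E = (Var x, t) # E' \<or> E = (t, Var x) # E'" for x t E'
  proof (cases "t = Var x")
    case True
    have "\<exists>\<sigma>. most_general_solution \<sigma> E'"
      using less.prems E by (intro less.hyps) (auto simp: True)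
    then show ?thesis
      by (simp add: most_general_solution_def True)
  next
    case False
    have x: "\<tau> x = subst_trm \<tau> t" and E': "solves \<tau> E'"
      using less.prems E by auto
    then have "x \<notin> vars_trm t"
      using size_subst_trm_var[of x t \<tau>] False by auto
    moreover have "\<exists>\<sigma>. most_general_solution \<sigma> (eliminate x t E')"
    proof (rule less.hyps)
      \<comment> \<open>\<open>\<tau>\<close> already equates \<open>x\<close> and \<open>t\<close>,
        so eliminating \<open>x\<close> preserves every summand; the decrease comes from the
        equation that is dropped.\<close>
      have "(\<Sum>(s, u)\<leftarrow>eliminate x t E'. Suc (size (subst_trm \<tau> s)))
        = (\<Sum>(s, u)\<leftarrow>E'. Suc (size (subst_trm \<tau> s)))"
        using subst_eliminated_var[of \<tau>, OF x]
        by (auto simp: o_def case_prod_unfold)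
      then show "(\<Sum>(s, u)\<leftarrow>eliminate x t E'. Suc (size (subst_trm \<tau> s)))
        < (\<Sum>(s, u)\<leftarrow>E. Suc (size (subst_trm \<tau> s)))"
        using E x by auto
    qed (use x E' solves_eliminated_var in blast)
    ultimately show ?thesis
      using most_general_solution_eliminate by blast
  qed
  consider "E = []" | x t E' where "E = (Var x, t) # E'" | x t E' where "E = (t, Var x) # E'"
    | f ss g ts E' where "E = (Fun f ss, Fun g ts) # E'"
    by (metis list.exhaust surj_pair trm.exhaust)
  then show ?case
  proof cases
    case 1
    then have "most_general_solution Var E"
      unfolding most_general_solution_def by (metis solves_simps(1) subst_trm.simps(1))
    then show ?thesis
      by blast
  next
    case 2
    then show ?thesis
      using eliminable by blast
  next
    case (3 x t E')
    then have "\<exists>\<sigma>. most_general_solution \<sigma> ((Var x, t) # E')"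
      using eliminable by blast
    then show ?thesis
      unfolding 3 most_general_solution_def solves_simps by (metis (no_types))
  next
    case (4 f ss g ts E')
    then have eq: "f = g" "map (subst_trm \<tau>) ss = map (subst_trm \<tau>) ts"
      using less.prems by auto
    have len: "length ss = length ts"
      using eq(2) by (rule map_eq_imp_length_eq)
    have same: "solves \<sigma> E \<longleftrightarrow> solves \<sigma> (zip ss ts @ E')" for \<sigma>
      by (simp add: 4 eq(1) solves_zip[OF len])
    \<comment> \<open>The size of an argument list also counts its length, which pays for the
      \<open>Suc\<close> of each new equation.\<close>
    have "(\<Sum>(s, t)\<leftarrow>zip ss ts. Suc (size (subst_trm \<tau> s)))
      = (\<Sum>s\<leftarrow>ss. size (subst_trm \<tau> s)) + length ss"
      using len by (induction ss ts rule: list_induct2) auto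
    then have "\<exists>\<sigma>. most_general_solution \<sigma> (zip ss ts @ E')"
      using less.prems same
      by (intro less.hyps) (auto simp: 4 size_list_conv_sum_list o_def)
    then show ?thesis
      by (simp add: most_general_solution_def same)
  qed
qed

lemma mgu_exists:
  assumes "unifier \<tau> A B"
  shows "\<exists>\<sigma>. mgu \<sigma> A B"
proof -
  have len: "name A = name B" "length (args A) = length (args B)"
    using assms by (auto simp: unifier_def subst_atom_def dest: map_eq_imp_length_eq)
  then have "unifier \<sigma> A B \<longleftrightarrow> solves \<sigma> (zip (args A) (args B))" for \<sigma>
    by (simp add: unifier_def subst_atom_def solves_zip)
  then show ?thesis
    using most_general_solution_exists assms by (simp add: mgu_def most_general_solution_def)
qed


section \<open>Resolvents of a clause\<close>

text \<open>The prefix version of \<open>supported\<close>: machines consume answers from left to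
  right, so between fork and return only an initial segment of the body is matched.
  \<open>list_all2\<close> also forces \<open>As\<close> to be no longer than the body.\<close>

definition covers :: "('p, 'f) clause \<Rightarrow> ('p, 'f) atom list \<Rightarrow> 'f subst \<Rightarrow> bool" where
  "covers c As \<tau> \<longleftrightarrow>
     list_all2 instance_of (map (subst_atom \<tau>) (take (length As) (body c))) As"

lemma covers_Nil [simp]: "covers c [] \<tau>"
  by (simp add: covers_def)

lemma covers_snoc:
  "covers c (As @ [A]) \<tau> \<longleftrightarrow> covers c As \<tau> \<and> length As < length (body c) \<and>
     instance_of (subst_atom \<tau> (body c ! length As)) A"
proof (cases "length As < length (body c)")
  case True
  then have "length (map (subst_atom \<tau>) (take (length As) (body c))) = length As"
    by simp
  with True show ?thesis
    by (simp add: covers_def take_Suc_conv_app_nth list_all2_append)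
next
  case False
  then show ?thesis
    by (auto simp: covers_def dest: list_all2_lengthD)
qed

lemma supported_iff_covers: "supported c As \<tau> \<longleftrightarrow> covers c As \<tau> \<and> length As = length (body c)"
proof -
  have "supported c As \<tau> \<Longrightarrow> length As = length (body c)"
    by (auto simp: supported_def dest: list_all2_lengthD)
  moreover have "supported c As \<tau> \<longleftrightarrow> covers c As \<tau>" if "length As = length (body c)"
    using that by (simp add: supported_def covers_def)
  ultimately show ?thesis
    by blast
qed

lemma covers_length: "covers c As \<tau> \<Longrightarrow> length As \<le> length (body c)"
  by (auto simp: covers_def dest: list_all2_lengthD)

lemma covers_subst: "covers c As \<sigma> \<Longrightarrow> covers c As (\<lambda>x. subst_trm \<delta> (\<sigma> x))"
  by (auto simp: covers_def list_all2_conv_all_nth subst_atom_comp[symmetric] instance_of_subst)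

text \<open>A single \<open>\<delta>\<close> has to serve the head, the consumed atoms and the
  remaining ones. It is demanded on the variables of \<open>c\<close> only: a renaming that moves
  \<open>c\<close> away from the goal may send other variables onto those of the goal, where the
  unifier is constrained.\<close>

definition most_general_cover :: "('p, 'f) clause \<Rightarrow> ('p, 'f) atom list \<Rightarrow> 'f subst \<Rightarrow> bool" where
  "most_general_cover c As \<sigma> \<longleftrightarrow> covers c As \<sigma> \<and>
     (\<forall>\<tau>. covers c As \<tau> \<longrightarrow> (\<exists>\<delta>. \<forall>x\<in>vars_clause c. \<tau> x = subst_trm \<delta> (\<sigma> x)))"

text \<open>The form of a machine that was forked for \<open>c\<close> and has consumed the answers \<open>As\<close>.\<close>

definition resolvent ::
  "('p, 'f) clause \<Rightarrow> ('p, 'f) atom list \<Rightarrow> ('p, 'f) clause \<Rightarrow> bool" where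
  "resolvent c As f \<longleftrightarrow> (\<exists>\<sigma>. most_general_cover c As \<sigma> \<and>
     f = Clause (subst_atom \<sigma> (head c)) (map (subst_atom \<sigma>) (drop (length As) (body c))))"

lemma subst_atom_factor:
  assumes "\<forall>x\<in>vars_clause c. \<tau> x = subst_trm \<delta> (\<sigma> x)" "B = head c \<or> B \<in> set (body c)"
  shows "subst_atom \<tau> B = subst_atom \<delta> (subst_atom \<sigma> B)"
  unfolding subst_atom_comp using assms
  by (intro subst_atom_cong) (auto intro: vars_clause_head vars_clause_body)

lemma most_general_cover_supported:
  assumes "most_general_cover c As \<sigma>" "length As = length (body c)"
  shows "most_general_supported c As \<sigma>"
proof -
  have "clause_instance_of (subst_clause \<tau> c) (subst_clause \<sigma> c)" if cov: "covers c As \<tau>" for \<tau>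
  proof -
    obtain \<delta> where \<delta>: "\<forall>x\<in>vars_clause c. \<tau> x = subst_trm \<delta> (\<sigma> x)"
      using assms(1) cov unfolding most_general_cover_def by blast
    then have "subst_clause \<tau> c = subst_clause \<delta> (subst_clause \<sigma> c)"
      using subst_atom_factor[OF \<delta>] by (simp add: subst_clause_def)
    then show ?thesis
      by (auto simp: clause_instance_of_def)
  qed
  then show ?thesis
    using assms by (simp add: most_general_supported_def supported_iff_covers most_general_cover_def)
qed

section \<open>Machines forked for a clause\<close>

lemma most_general_goal_simps [simp]:
  "name (most_general_goal p) = fst p"
  "args (most_general_goal p) = map Var [0..<snd p]"
  "pred (most_general_goal p) = p"
  by (simp_all add: most_general_goal_def pred_def)

lemma vars_most_general_goal: "vars_atom (most_general_goal p) = {0..<snd p}"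
  by (auto simp: vars_atom_def)

lemma instance_of_most_general_goal:
  assumes "\<And>i. i < length (args A) \<Longrightarrow> \<sigma> i = args A ! i"
  shows "subst_atom \<sigma> (most_general_goal (pred A)) = A"
  using assms by (cases A) (auto simp: subst_atom_def most_general_goal_def pred_def intro!: nth_equalityI)

text \<open>Every \<open>\<tau>\<close> is realized by some unifier of goal and head: variables of
  the goal are bound to the arguments of the instantiated head, all others undo the renaming and
  then follow \<open>\<tau>\<close>. Apartness keeps the two cases from colliding on the variables
  of \<open>c\<close>.\<close>

lemma unifies_most_general_goal:
  assumes \<pi>: "bij \<pi>" and apart: "\<pi> ` vars_clause c \<inter> vars_atom (most_general_goal p) = {}"
    and p: "pred (head c) = p"
  obtains \<kappa> where "unifier \<kappa> (most_general_goal p) (subst_atom (Var \<circ> \<pi>) (head c))"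
    "\<And>x. x \<in> vars_clause c \<Longrightarrow> \<kappa> (\<pi> x) = \<tau> x"
proof -
  define \<kappa> where "\<kappa> v = (if v < snd p then args (subst_atom \<tau> (head c)) ! v else \<tau> (inv \<pi> v))" for v
  have eq: "\<kappa> (\<pi> x) = \<tau> x" if "x \<in> vars_clause c" for x
    using apart that \<pi> by (auto simp: \<kappa>_def vars_most_general_goal bij_is_inj)
  have "subst_atom \<kappa> (subst_atom (Var \<circ> \<pi>) (head c)) = subst_atom \<tau> (head c)"
    using eq vars_clause_head by (auto simp: subst_atom_comp intro!: subst_atom_cong)
  moreover have "subst_atom \<kappa> (most_general_goal (pred (subst_atom \<tau> (head c)))) = subst_atom \<tau> (head c)"
    using p by (intro instance_of_most_general_goal) (auto simp: \<kappa>_def pred_def)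
  ultimately have "unifier \<kappa> (most_general_goal p) (subst_atom (Var \<circ> \<pi>) (head c))"
    using p by (simp add: unifier_def)
  then show ?thesis
    using eq that by blast
qed

lemma rule_machine_exists:
  assumes "pred (head c) = p"
  shows "\<exists>m. rule_machine p c m"
proof -
  obtain \<pi> where \<pi>: "bij \<pi>" "\<pi> ` vars_clause c \<inter> vars_atom (most_general_goal p :: ('a, 'b) atom) = {}"
    using fresh_renaming[OF finite_vars_atom finite_vars_clause] .
  obtain \<kappa> where "unifier \<kappa> (most_general_goal p) (subst_atom (Var \<circ> \<pi>) (head c))"
    using unifies_most_general_goal[OF \<pi> assms, where \<tau> = Var] by blast
  then obtain \<sigma> where "mgu \<sigma> (most_general_goal p) (subst_atom (Var \<circ> \<pi>) (head c))"
    using mgu_exists by blast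
  moreover have "renaming (Var \<circ> \<pi>)"
    "vars_clause (subst_clause (Var \<circ> \<pi>) c) \<inter> vars_atom (most_general_goal p :: ('a, 'b) atom) = {}"
    using \<pi> by (auto simp: renaming_def vars_subst_clause)
  ultimately show ?thesis
    unfolding rule_machine_def by blast
qed

lemma rule_machine_origin: "rule_machine p c m \<Longrightarrow> origin m = Some c"
  by (auto simp: rule_machine_def)

text \<open>Full abstraction enters here: a most-general goal puts no constraint on the head, so
  every instance of \<open>c\<close> factors through \<open>\<sigma> \<circ> \<pi>\<close>. The
  forked machine thus stands for the whole clause, as a rule process does.\<close>

lemma rule_machine_resolvent:
  assumes "rule_machine p c m" "pred (head c) = p"
  shows "resolvent c [] (form m)"
proof -
  obtain \<pi> \<sigma> where \<pi>: "bij \<pi>" and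
    apart: "\<pi> ` vars_clause c \<inter> vars_atom (most_general_goal p :: ('a, 'b) atom) = {}" and
    \<sigma>: "mgu \<sigma> (most_general_goal p) (subst_atom (Var \<circ> \<pi>) (head c))" and
    form: "form m = Clause (subst_atom \<sigma> (most_general_goal p))
         (map (subst_atom \<sigma>) (body (subst_clause (Var \<circ> \<pi>) c)))"
  proof -
    obtain \<rho> \<sigma> where "renaming \<rho>" and
      \<rho>: "vars_clause (subst_clause \<rho> c) \<inter> vars_atom (most_general_goal p :: ('a, 'b) atom) = {}"
        "mgu \<sigma> (most_general_goal p) (subst_atom \<rho> (head c))"
        "m = Machine (Some c) (Clause (subst_atom \<sigma> (most_general_goal p))
          (map (subst_atom \<sigma>) (body (subst_clause \<rho> c))))"
      using assms(1) unfolding rule_machine_def by blast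
    moreover from this(1) obtain \<pi> where "bij \<pi>" "\<rho> = Var \<circ> \<pi>"
      unfolding renaming_def by blast
    ultimately show thesis
      using that[of \<pi> \<sigma>] by (auto simp: vars_subst_clause)
  qed
  have "\<exists>\<delta>. \<forall>x\<in>vars_clause c. \<tau> x = subst_trm \<delta> (\<sigma> (\<pi> x))" for \<tau>
  proof -
    obtain \<kappa> where "unifier \<kappa> (most_general_goal p) (subst_atom (Var \<circ> \<pi>) (head c))"
      "\<And>x. x \<in> vars_clause c \<Longrightarrow> \<kappa> (\<pi> x) = \<tau> x"
      using unifies_most_general_goal[OF \<pi> apart assms(2), where \<tau> = \<tau>] by blast
    then show ?thesis
      using \<sigma> unfolding mgu_def by metis
  qed
  then have "most_general_cover c [] (\<sigma> \<circ> \<pi>)"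
    by (simp add: most_general_cover_def)
  moreover have "form m = Clause (subst_atom (\<sigma> \<circ> \<pi>) (head c)) (map (subst_atom (\<sigma> \<circ> \<pi>)) (body c))"
    using \<sigma> by (simp add: form mgu_def unifier_def subst_atom_comp o_def)
  ultimately show ?thesis
    unfolding resolvent_def by auto
qed

section \<open>Consuming an answer\<close>

lemma resumes_with_exists:
  assumes "unifies_with_answer m A"
  shows "\<exists>m'. resumes_with m A m'"
  using assms mgu_exists unfolding unifies_with_answer_def resumes_with_def by blast

lemma resumes_with_origin: "resumes_with m A m' \<Longrightarrow> origin m' = origin m"
  by (auto simp: resumes_with_def)

text \<open>A machine cannot fail on an answer that some instance of its clause matches. The unifier
  is glued together from \<open>\<delta>\<close>, which most generality gives on the variables of
  the machine, and \<open>\<epsilon>\<close> on the fresh copy of the answer.\<close>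

lemma resolvent_unifies:
  assumes res: "resolvent c As (form m)" and "covers c (As @ [A]) \<tau>"
  shows "unifies_with_answer m A"
proof -
  let ?B = "body c ! length As"
  from assms(2) have cov: "covers c As \<tau>" "length As < length (body c)"
    "instance_of (subst_atom \<tau> ?B) A"
    by (auto simp: covers_snoc)
  obtain \<sigma> where \<sigma>: "most_general_cover c As \<sigma>" and
    form: "form m = Clause (subst_atom \<sigma> (head c)) (map (subst_atom \<sigma>) (drop (length As) (body c)))"
    using res by (auto simp: resolvent_def)
  obtain \<delta> where \<delta>: "\<forall>x\<in>vars_clause c. \<tau> x = subst_trm \<delta> (\<sigma> x)"
    using \<sigma> cov(1) unfolding most_general_cover_def by blast
  obtain A' where A': "variant A A'" "vars_clause (form m) \<inter> vars_atom A' = {}"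
    using fresh_variant[OF finite_vars_clause] .
  obtain \<epsilon> where \<epsilon>: "subst_atom \<tau> ?B = subst_atom \<epsilon> A'"
    using instance_of_trans[OF cov(3) variant_imp_instance_of[OF A'(1)]]
    by (auto simp: instance_of_def)
  have hd: "hd (body (form m)) = subst_atom \<sigma> ?B"
    using cov(2) by (simp add: form hd_map hd_drop_conv_nth)
  have vars: "vars_atom (subst_atom \<sigma> ?B) \<subseteq> vars_clause (form m)"
    using vars_clause_body[of "subst_atom \<sigma> ?B" "form m"] cov(2)
    by (auto simp: form Cons_nth_drop_Suc[symmetric])
  define \<kappa> where "\<kappa> v = (if v \<in> vars_atom A' then \<epsilon> v else \<delta> v)" for v
  have "subst_atom \<kappa> (subst_atom \<sigma> ?B) = subst_atom \<delta> (subst_atom \<sigma> ?B)"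
    using vars A'(2) by (intro subst_atom_cong) (auto simp: \<kappa>_def)
  also have "\<dots> = subst_atom \<tau> ?B"
    using subst_atom_factor[OF \<delta>] cov(2) by simp
  also have "\<dots> = subst_atom \<kappa> A'"
    unfolding \<epsilon> by (intro subst_atom_cong) (auto simp: \<kappa>_def)
  finally have "unifier \<kappa> (hd (body (form m))) A'"
    by (simp add: unifier_def hd)
  with A' show ?thesis
    unfolding unifies_with_answer_def renamed_apart_def by blast
qed

text \<open>Each consumed answer lengthens the covered prefix by one atom. The delicate half is that
  most generality survives: every \<open>\<tau>\<close> must factor on all variables of
  \<open>c\<close>, including those that occur only in atoms consumed before.\<close>

lemma resolvent_resumes:
  assumes res: "resolvent c As (form m)" and nonempty: "body (form m) \<noteq> []"
    and "resumes_with m A m'"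
  shows "resolvent c (As @ [A]) (form m')"
proof -
  let ?B = "body c ! length As"
  obtain \<sigma> where \<sigma>: "most_general_cover c As \<sigma>" and
    form: "form m = Clause (subst_atom \<sigma> (head c)) (map (subst_atom \<sigma>) (drop (length As) (body c)))"
    using res by (auto simp: resolvent_def)
  have len: "length As < length (body c)"
    using nonempty by (auto simp: form)
  have drop: "drop (length As) (body c) = ?B # drop (Suc (length As)) (body c)"
    using len by (simp add: Cons_nth_drop_Suc)
  obtain A' \<theta> where A': "variant A A'" "vars_clause (form m) \<inter> vars_atom A' = {}" and
    \<theta>: "mgu \<theta> (subst_atom \<sigma> ?B) A'" and
    form': "form m' = Clause (subst_atom \<theta> (subst_atom \<sigma> (head c)))
      (map (subst_atom \<theta>) (map (subst_atom \<sigma>) (drop (Suc (length As)) (body c))))"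
    using assms(3) by (auto simp: resumes_with_def renamed_apart_def form drop)
  let ?V = "vars_clause (form m)"
  \<comment> \<open>The answer is renamed apart only from what is left of the clause instance, but it may share
    variables with the body atoms resolved before. Those variables are shifted out of the way.\<close>
  have "finite (?V \<union> vars_atom A' \<union> vars_clause (subst_clause \<sigma> c))"
    by simp
  then obtain N where N: "\<And>v. v \<in> ?V \<union> vars_atom A' \<union> vars_clause (subst_clause \<sigma> c) \<Longrightarrow> v < N"
    by (metis finite_nat_set_iff_bounded)
  define \<rho> where "\<rho> v = (if v \<in> ?V then Var v else Var (v + N) :: 'b trm)" for v
  define \<sigma>' where "\<sigma>' x = subst_trm \<theta> (subst_trm \<rho> (\<sigma> x))" for x
  \<comment> \<open>The shift is the identity on the head and the remaining atoms, so the form of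
    the machine does not see it.\<close>
  have \<sigma>'_eq: "subst_atom \<sigma>' B = subst_atom \<theta> (subst_atom \<sigma> B)"
    if "B = head c \<or> B \<in> set (drop (length As) (body c))" for B
  proof -
    have "vars_atom (subst_atom \<sigma> B) \<subseteq> ?V"
      using that by (auto simp: vars_clause_def form)
    then have "subst_atom \<rho> (subst_atom \<sigma> B) = subst_atom Var (subst_atom \<sigma> B)"
      by (intro subst_atom_cong) (auto simp: \<rho>_def)
    then show ?thesis
      by (simp add: \<sigma>'_def[abs_def] subst_atom_comp[symmetric])
  qed
  have B: "subst_atom \<sigma>' ?B = subst_atom \<theta> (subst_atom \<sigma> ?B)"
    by (rule \<sigma>'_eq) (simp add: drop)
  have "covers c As \<sigma>'"
    using \<sigma> unfolding \<sigma>'_def most_general_cover_def by (intro covers_subst) blast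
  moreover have "instance_of (subst_atom \<sigma>' ?B) A"
  proof -
    have "subst_atom \<sigma>' ?B = subst_atom \<theta> A'"
      using \<theta> B by (simp add: mgu_def unifier_def)
    then show ?thesis
      using instance_of_subst variant_imp_instance_of[OF variant_sym[OF A'(1)]] by metis
  qed
  ultimately have cov: "covers c (As @ [A]) \<sigma>'"
    using len by (simp add: covers_snoc)
  moreover have "\<exists>\<delta>. \<forall>x\<in>vars_clause c. \<tau> x = subst_trm \<delta> (\<sigma>' x)" if "covers c (As @ [A]) \<tau>" for \<tau>
  proof -
    from that have \<tau>: "covers c As \<tau>" "instance_of (subst_atom \<tau> ?B) A"
      by (auto simp: covers_snoc)
    obtain \<delta> where \<delta>: "\<forall>x\<in>vars_clause c. \<tau> x = subst_trm \<delta> (\<sigma> x)"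
      using \<sigma> \<tau>(1) unfolding most_general_cover_def by blast
    obtain \<epsilon> where \<epsilon>: "subst_atom \<tau> ?B = subst_atom \<epsilon> A'"
      using instance_of_trans[OF \<tau>(2) variant_imp_instance_of[OF A'(1)]]
      by (auto simp: instance_of_def)
    \<comment> \<open>Variables of the answer follow \<open>\<epsilon>\<close>, those of the form
      follow \<open>\<delta>\<close>, and shifted ones follow \<open>\<delta>\<close> after undoing
      the shift. As \<open>N\<close> exceeds the first two kinds, no shifted variable is mistaken
      for one of them.\<close>
    define \<kappa> where
      "\<kappa> v = (if v \<in> vars_atom A' then \<epsilon> v else if v \<in> ?V then \<delta> v else \<delta> (v - N))" for v
    have \<kappa>_\<rho>: "subst_trm \<kappa> (\<rho> v) = \<delta> v" if "v \<in> vars_clause (subst_clause \<sigma> c)" for v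
    proof -
      have "v + N \<notin> ?V" "v + N \<notin> vars_atom A'"
        using N[of "v + N"] by auto
      then show ?thesis
        using A'(2) by (auto simp: \<kappa>_def \<rho>_def)
    qed
    have \<kappa>: "\<tau> x = subst_trm \<kappa> (subst_trm \<rho> (\<sigma> x))" if "x \<in> vars_clause c" for x
    proof -
      have "subst_trm \<kappa> (subst_trm \<rho> (\<sigma> x)) = subst_trm \<delta> (\<sigma> x)"
        using that \<kappa>_\<rho> unfolding subst_trm_comp
        by (intro subst_trm_cong) (auto simp: vars_subst_clause)
      then show ?thesis
        using \<delta> that by simp
    qed
    have "subst_atom \<kappa> (subst_atom \<sigma> ?B) = subst_atom \<delta> (subst_atom \<sigma> ?B)"
    proof (intro subst_atom_cong)
      fix v assume "v \<in> vars_atom (subst_atom \<sigma> ?B)"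
      then have "v \<in> ?V"
        by (auto simp: vars_clause_def form drop)
      then show "\<kappa> v = \<delta> v"
        using A'(2) by (auto simp: \<kappa>_def)
    qed
    also have "\<dots> = subst_atom \<tau> ?B"
      using subst_atom_factor[OF \<delta>] len by simp
    also have "\<dots> = subst_atom \<kappa> A'"
      unfolding \<epsilon> by (intro subst_atom_cong) (auto simp: \<kappa>_def)
    finally have "unifier \<kappa> (subst_atom \<sigma> ?B) A'"
      by (simp add: unifier_def)
    \<comment> \<open>As \<open>\<theta>\<close> is most general, \<open>\<kappa>\<close> factors
      through it. On the variables of \<open>c\<close>, \<open>\<tau>\<close> is
      \<open>\<kappa>\<close> applied after \<open>\<rho>\<close> and \<open>\<sigma>\<close>, hence
      it factors through \<open>\<sigma>'\<close>.\<close>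
    then obtain \<delta>' where "\<And>v. \<kappa> v = subst_trm \<delta>' (\<theta> v)"
      using \<theta> unfolding mgu_def by blast
    then have "subst_trm \<kappa> t = subst_trm \<delta>' (subst_trm \<theta> t)" for t
      unfolding subst_trm_comp by (intro subst_trm_cong)
    then show ?thesis
      using \<kappa> by (auto simp: \<sigma>'_def)
  qed
  ultimately have "most_general_cover c (As @ [A]) \<sigma>'"
    by (simp add: most_general_cover_def)
  moreover have "form m' = Clause (subst_atom \<sigma>' (head c))
      (map (subst_atom \<sigma>') (drop (length (As @ [A])) (body c)))"
    using \<sigma>'_eq by (auto simp: form' drop)
  ultimately show ?thesis
    unfolding resolvent_def by blast
qed

lemma resolvent_pred_head: "resolvent c As f \<Longrightarrow> pred (head f) = pred (head c)"
  by (auto simp: resolvent_def)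


section \<open>Facts over a signature\<close>

lemma herbrand_universe_Fun [simp]:
  "Fun f ts \<in> herbrand_universe F \<longleftrightarrow> (f, length ts) \<in> F \<and> set ts \<subseteq> herbrand_universe F"
  by (auto intro: herbrand_universe.intros elim: herbrand_universe.cases)

lemma herbrand_universe_Var [simp]: "Var x \<notin> herbrand_universe F"
  by (auto elim: herbrand_universe.cases)

lemma funs_herbrand_universe: "t \<in> herbrand_universe F \<Longrightarrow> funs_trm t \<subseteq> F"
  by (induction t) auto

lemma subst_in_herbrand_universe:
  "ground_subst F \<gamma> \<Longrightarrow> funs_trm t \<subseteq> F \<Longrightarrow> subst_trm \<gamma> t \<in> herbrand_universe F"
  by (induction t) (auto simp: ground_subst_def)

lemma subst_in_herbrand_base:
  "ground_subst F \<gamma> \<Longrightarrow> funs_atom A \<subseteq> F \<Longrightarrow> subst_atom \<gamma> A \<in> herbrand_base F"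
  by (auto simp: herbrand_base_def funs_atom_def intro!: subst_in_herbrand_universe)

lemma funs_atom_ground_instance:
  "subst_atom \<delta> A \<in> herbrand_base F \<Longrightarrow> funs_atom A \<subseteq> F"
  using funs_subst_trm funs_herbrand_universe by (fastforce simp: herbrand_base_def funs_atom_def)

lemma funs_atom_clause:
  "funs_program H \<subseteq> F \<Longrightarrow> c \<in> H \<Longrightarrow> B = head c \<or> B \<in> set (body c) \<Longrightarrow> funs_atom B \<subseteq> F"
  by (fastforce simp: funs_program_def)

text \<open>Unifiers and the instances compared by \<open>most_general_supported\<close> may use function symbols
  outside the signature. Cutting terms off at such symbols and at variables turns any instance of
  an atom over the signature into a ground instance over the signature.\<close>

primrec collapse :: "('f \<times> nat) set \<Rightarrow> 'f \<Rightarrow> 'f trm \<Rightarrow> 'f trm" where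
  "collapse F a (Var x) = Fun a []"
| "collapse F a (Fun f ts) =
     (if (f, length ts) \<in> F then Fun f (map (collapse F a) ts) else Fun a [])"

lemma collapse_in_herbrand_universe: "(a, 0) \<in> F \<Longrightarrow> collapse F a t \<in> herbrand_universe F"
  by (induction t) auto

lemma collapse_ground: "t \<in> herbrand_universe F \<Longrightarrow> collapse F a t = t"
  by (induction t) (auto intro!: map_idI)

text \<open>No cut happens in \<open>t\<close> itself, whose symbols all belong to \<open>F\<close>;
  cuts take place only inside the substituted terms.\<close>

lemma collapse_subst_trm:
  "funs_trm t \<subseteq> F \<Longrightarrow> collapse F a (subst_trm \<sigma> t) = subst_trm (\<lambda>x. collapse F a (\<sigma> x)) t"
  by (induction t) (auto simp: UN_subset_iff)

definition collapse_atom :: "('f \<times> nat) set \<Rightarrow> 'f \<Rightarrow> ('p, 'f) atom \<Rightarrow> ('p, 'f) atom" where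
  "collapse_atom F a A = Atom (name A) (map (collapse F a) (args A))"

lemma collapse_atom_ground: "A \<in> herbrand_base F \<Longrightarrow> collapse_atom F a A = A"
  by (cases A) (auto simp: collapse_atom_def herbrand_base_def collapse_ground intro!: map_idI)

lemma collapse_subst_atom:
  "funs_atom A \<subseteq> F \<Longrightarrow>
     collapse_atom F a (subst_atom \<sigma> A) = subst_atom (\<lambda>x. collapse F a (\<sigma> x)) A"
  by (auto simp: collapse_atom_def subst_atom_def funs_atom_def UN_subset_iff collapse_subst_trm)

lemma instance_of_collapse:
  assumes "instance_of (subst_atom \<sigma> B) A" "funs_atom A \<subseteq> F" "funs_atom B \<subseteq> F"
  shows "instance_of (subst_atom (\<lambda>x. collapse F a (\<sigma> x)) B) A"
proof -
  obtain \<epsilon> where "subst_atom \<sigma> B = subst_atom \<epsilon> A"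
    using assms(1) by (auto simp: instance_of_def)
  then show ?thesis
    using collapse_subst_atom[OF assms(2), of a \<epsilon>] collapse_subst_atom[OF assms(3), of a \<sigma>]
    unfolding instance_of_def by (intro exI[of _ "\<lambda>x. collapse F a (\<epsilon> x)"]) simp
qed

lemma supported_collapse:
  assumes "supported c As \<sigma>" "\<forall>A\<in>set As. funs_atom A \<subseteq> F" "\<forall>B\<in>set (body c). funs_atom B \<subseteq> F"
  shows "supported c As (\<lambda>x. collapse F a (\<sigma> x))"
  using assms by (auto simp: supported_def list_all2_conv_all_nth intro!: instance_of_collapse)

lemma ground_subst_collapse: "(a, 0) \<in> F \<Longrightarrow> ground_subst F (\<lambda>x. collapse F a (\<sigma> x))"
  by (simp add: ground_subst_def collapse_in_herbrand_universe)

text \<open>Collapsing \<open>\<sigma>\<close> gives another supported instance, this one over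
  \<open>F\<close>. It is an instance of the most general one, and instantiation never removes
  function symbols.\<close>

lemma funs_atom_derived:
  assumes mgs: "most_general_supported c As \<sigma>" and As: "\<forall>A\<in>set As. funs_atom A \<subseteq> F"
    and c: "funs_program H \<subseteq> F" "c \<in> H" and a: "(a, 0) \<in> F"
  shows "funs_atom (subst_atom \<sigma> (head c)) \<subseteq> F"
proof -
  let ?\<tau> = "\<lambda>x. collapse F a (\<sigma> x)"
  have "supported c As ?\<tau>"
    using mgs As funs_atom_clause[OF c] unfolding most_general_supported_def
    by (intro supported_collapse) auto
  then obtain \<delta> where "subst_clause ?\<tau> c = subst_clause \<delta> (subst_clause \<sigma> c)"
    using mgs by (auto simp: most_general_supported_def clause_instance_of_def)
  then have "subst_atom ?\<tau> (head c) = subst_atom \<delta> (subst_atom \<sigma> (head c))"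
    by (metis subst_clause_simps(1))
  moreover have "subst_atom ?\<tau> (head c) \<in> herbrand_base F"
    using ground_subst_collapse[OF a] funs_atom_clause[OF c] by (intro subst_in_herbrand_base) auto
  ultimately show ?thesis
    using funs_atom_ground_instance by metis
qed

lemma ground_instances_mono: "S \<subseteq> T \<Longrightarrow> ground_instances F S \<subseteq> ground_instances F T"
  by (auto simp: ground_instances_def)

text \<open>\<open>\<tau>\<close> after \<open>\<sigma>\<close> may stay non-ground or leave the
  signature on variables that do not show in \<open>A\<close>. Collapsing repairs this and fixes
  \<open>A\<close>, which is already ground over \<open>F\<close>.\<close>

lemma ground_instances_derived:
  assumes supp: "supported c As \<sigma>" and As: "set As \<subseteq> S" "\<forall>A\<in>S. funs_atom A \<subseteq> F"
    and c: "funs_program H \<subseteq> F" "c \<in> H" and a: "(a, 0) \<in> F"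
    and A: "A \<in> herbrand_base F" "instance_of A (subst_atom \<sigma> (head c))"
  shows "\<exists>\<gamma>. ground_subst F \<gamma> \<and> subst_atom \<gamma> ` set (body c) \<subseteq> ground_instances F S \<and>
    A = subst_atom \<gamma> (head c)"
proof -
  obtain \<tau> where \<tau>: "A = subst_atom \<tau> (subst_atom \<sigma> (head c))"
    using A(2) by (auto simp: instance_of_def)
  define \<gamma> where "\<gamma> x = collapse F a (subst_trm \<tau> (\<sigma> x))" for x
  have "supported c As (\<lambda>x. subst_trm \<tau> (\<sigma> x))"
    using supp covers_subst unfolding supported_iff_covers by blast
  then have supp_\<gamma>: "supported c As \<gamma>"
    unfolding \<gamma>_def using As funs_atom_clause[OF c] by (intro supported_collapse) auto
  have ground: "ground_subst F \<gamma>"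
    unfolding \<gamma>_def using ground_subst_collapse[OF a] .
  have "A = collapse_atom F a A"
    using A(1) by (simp add: collapse_atom_ground)
  also have "\<dots> = subst_atom \<gamma> (head c)"
    unfolding \<tau> subst_atom_comp \<gamma>_def[abs_def] using funs_atom_clause[OF c]
    by (intro collapse_subst_atom) auto
  finally have "A = subst_atom \<gamma> (head c)" .
  moreover have "subst_atom \<gamma> ` set (body c) \<subseteq> ground_instances F S"
  proof
    fix B assume "B \<in> subst_atom \<gamma> ` set (body c)"
    then obtain B' where B': "B' \<in> set (body c)" "B = subst_atom \<gamma> B'"
      by blast
    then obtain D where "D \<in> set As" "instance_of B D"
      using supp_\<gamma> by (fastforce simp: supported_def list_all2_conv_all_nth in_set_conv_nth)
    moreover have "B \<in> herbrand_base F"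
      using B' ground funs_atom_clause[OF c] by (auto intro: subst_in_herbrand_base)
    ultimately show "B \<in> ground_instances F S"
      using As(1) by (auto simp: ground_instances_def)
  qed
  ultimately show ?thesis
    using ground by blast
qed

section \<open>Ground runs and the least Herbrand model\<close>

lemma bottom_up_run_step:
  assumes "bottom_up_run H S r"
  shows "case r n of None \<Rightarrow> S (Suc n) = S n
    | Some c \<Rightarrow> c \<in> H \<and> (\<exists>A. adds_fact c (S n) A \<and> S (Suc n) = insert A (S n))"
  using assms unfolding bottom_up_run_def by blast

lemma ground_bottom_up_run_step:
  assumes "ground_bottom_up_run F H S r"
  shows "case r n of None \<Rightarrow> S (Suc n) = S n
    | Some c \<Rightarrow> c \<in> H \<and> S n \<subseteq> S (Suc n) \<and>
        (\<forall>A \<in> S (Suc n) - S n. adds_ground_fact F c (S n) A)"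
  using assms unfolding ground_bottom_up_run_def by blast

lemma bottom_up_run_funs:
  assumes run: "bottom_up_run H S r" and H: "funs_program H \<subseteq> F" and a: "(a, 0) \<in> F"
  shows "A \<in> S n \<Longrightarrow> funs_atom A \<subseteq> F"
proof (induction n arbitrary: A)
  case 0
  then show ?case
    using run by (simp add: bottom_up_run_def)
next
  case (Suc n)
  show ?case
  proof (cases "A \<in> S n")
    case True
    then show ?thesis
      using Suc.IH by blast
  next
    case False
    then obtain c where "c \<in> H" "adds_fact c (S n) A"
      using bottom_up_run_step[OF run, of n] Suc.prems by (auto split: option.splits)
    then show ?thesis
      using Suc.IH funs_atom_derived[OF _ _ H _ a] by (fastforce simp: adds_fact_def)
  qed
qed

text \<open>The same schedule serves both levels: adding a fact adds all its ground instances at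
  once, and each one not yet present is derived by the same clause from earlier ground facts. If all
  of them are present, the ground step adds nothing.\<close>

lemma ground_bottom_up_run_if_bottom_up_run:
  assumes run: "bottom_up_run H S r" and H: "funs_program H \<subseteq> F" and a: "(a, 0) \<in> F"
  shows "ground_bottom_up_run F H (\<lambda>n. ground_instances F (S n)) r"
proof -
  have "case r n of
        None \<Rightarrow> ground_instances F (S (Suc n)) = ground_instances F (S n)
      | Some c \<Rightarrow> c \<in> H \<and> ground_instances F (S n) \<subseteq> ground_instances F (S (Suc n)) \<and>
          (\<forall>A \<in> ground_instances F (S (Suc n)) - ground_instances F (S n).
             adds_ground_fact F c (ground_instances F (S n)) A)" for n
  proof (cases "r n")
    case None
    then have "S (Suc n) = S n"
      using bottom_up_run_step[OF run, of n] by simp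
    then show ?thesis
      by (simp add: None)
  next
    case (Some c)
    then obtain A where c: "c \<in> H" and S: "S (Suc n) = insert A (S n)" and "adds_fact c (S n) A"
      using bottom_up_run_step[OF run, of n] by auto
    then obtain As \<sigma> where A: "set As \<subseteq> S n" "supported c As \<sigma>" "A = subst_atom \<sigma> (head c)"
      unfolding adds_fact_def most_general_supported_def by blast
    have "adds_ground_fact F c (ground_instances F (S n)) B"
      if "B \<in> ground_instances F (S (Suc n)) - ground_instances F (S n)" for B
    proof -
      have B: "B \<in> herbrand_base F" "instance_of B (subst_atom \<sigma> (head c))" "B \<notin> ground_instances F (S n)"
        using that unfolding ground_instances_def S A(3)[symmetric] by auto
      have "\<forall>A\<in>S n. funs_atom A \<subseteq> F"
        using bottom_up_run_funs[OF run H a] by blast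
      then show ?thesis
        using ground_instances_derived[OF A(2) A(1) _ H c a B(1,2)] B(3)
        unfolding adds_ground_fact_def by blast
    qed
    then show ?thesis
      using c ground_instances_mono[of "S n" "S (Suc n)" F] S unfolding Some by auto
  qed
  moreover have "ground_instances F (S 0) = {}"
    using run by (simp add: bottom_up_run_def ground_instances_def)
  ultimately show ?thesis
    unfolding ground_bottom_up_run_def by blast
qed

text \<open>Since \<open>F\<close> contains the symbols of the program, the Herbrand base is itself
  a model. The intersection is thus over a nonempty family and stays inside the base.\<close>

lemma herbrand_model_least:
  assumes "funs_program H \<subseteq> F"
  shows "herbrand_model F H (least_herbrand_model F H)"
proof -
  have "herbrand_model F H (herbrand_base F)"
    using funs_atom_clause[OF assms] by (auto simp: herbrand_model_def intro!: subst_in_herbrand_base)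
  then show ?thesis
    unfolding herbrand_model_def least_herbrand_model_def by blast
qed

lemma least_herbrand_model_subset: "herbrand_model F H I \<Longrightarrow> least_herbrand_model F H \<subseteq> I"
  by (auto simp: least_herbrand_model_def)

lemma ground_bottom_up_run_sound:
  assumes run: "ground_bottom_up_run F H S r" and H: "funs_program H \<subseteq> F"
  shows "S n \<subseteq> least_herbrand_model F H"
proof (induction n)
  case 0
  then show ?case
    using run by (simp add: ground_bottom_up_run_def)
next
  case (Suc n)
  show ?case
  proof (cases "r n")
    case None
    then have "S (Suc n) = S n"
      using ground_bottom_up_run_step[OF run, of n] by simp
    then show ?thesis
      using Suc by simp
  next
    case (Some c)
    then have c: "c \<in> H" "\<forall>A \<in> S (Suc n) - S n. adds_ground_fact F c (S n) A"
      using ground_bottom_up_run_step[OF run, of n] by auto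
    show ?thesis
    proof
      fix A assume A: "A \<in> S (Suc n)"
      show "A \<in> least_herbrand_model F H"
      proof (cases "A \<in> S n")
        case False
        then obtain \<gamma> where \<gamma>: "ground_subst F \<gamma>" "subst_atom \<gamma> ` set (body c) \<subseteq> S n"
          "A = subst_atom \<gamma> (head c)"
          using A c(2) unfolding adds_ground_fact_def by blast
        then have "subst_atom \<gamma> ` set (body c) \<subseteq> least_herbrand_model F H"
          using Suc by blast
        then show ?thesis
          using \<gamma>(1,3) c(1) herbrand_model_least[OF H] unfolding herbrand_model_def by blast
      qed (use Suc in blast)
    qed
  qed
qed


section \<open>Evaluations\<close>

declare split_paired_Ex [simp del] split_paired_All [simp del]

section \<open>Invariants of a single step\<close>

definition waiting :: "('p, 'f) state \<Rightarrow> 'p predicate \<Rightarrow> ('p, 'f) machine \<Rightarrow> nat \<Rightarrow> bool" where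
  "waiting s p m i \<longleftrightarrow> (\<exists>e. table s p = Some e \<and> (m, i) \<in># suspended e)"

definition present :: "('p, 'f) state \<Rightarrow> ('p, 'f) machine \<Rightarrow> bool" where
  "present s m \<longleftrightarrow> m \<in># running s \<or> (\<exists>p i. waiting s p m i)"

lemma table_answersI: "table s p = Some e \<Longrightarrow> A \<in> set (answers e) \<Longrightarrow> A \<in> table_answers s"
  by (auto simp: table_answers_def)

lemma set_add_answer: "set (add_answer A As) =
    (if \<exists>B\<in>set As. variant A B then set As else insert A (set As))"
  by (simp add: add_answer_def)

lemma step_table_mono:
  assumes "step H oper s t" "table s p = Some e"
  shows "\<exists>e' as. table t p = Some e' \<and> answers e' = answers e @ as"
  using assms by (cases rule: step.cases) (auto simp: add_answer_def)

lemma step_table_answers_mono: "step H oper s t \<Longrightarrow> table_answers s \<subseteq> table_answers t"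
  unfolding table_answers_def by (fastforce dest: step_table_mono)

lemma step_table_new:
  assumes "step H oper s t" "table s p = None" "table t p \<noteq> None"
  obtains m fork where "oper = Call m" "\<forall>c\<in>clauses_for H p. rule_machine p c (fork c)"
    "running t = running s - {#m#} + image_mset fork (mset_set (clauses_for H p))"
  using assms by (cases rule: step.cases) (auto split: if_splits)

lemma step_answers:
  assumes "step H oper s t" "table t p = Some e" "A \<in> set (answers e)"
  shows "(\<exists>e'. table s p = Some e' \<and> A \<in> set (answers e')) \<or> pred A = p"
  using assms by (cases rule: step.cases) (auto split: if_splits simp: set_add_answer)

lemma step_waiting:
  assumes "step H oper s t" "waiting t p m i"
  shows "(\<exists>i. waiting s p m i) \<or> m \<in># running s \<and> (\<exists>B Bs. body (form m) = B # Bs \<and> pred B = p)"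
  using assms
  by (cases rule: step.cases) (auto simp: waiting_def split: if_splits dest!: in_diffD)

lemma step_running:
  assumes "finite H" "step H oper s t" "m \<in># running t"
  shows "m \<in># running s \<or>
    (\<exists>p c. table t p \<noteq> None \<and> c \<in> clauses_for H p \<and> rule_machine p c m) \<or>
    (\<exists>p e m' i. table s p = Some e \<and> (m', i) \<in># suspended e \<and> i < length (answers e) \<and>
       resumes_with m' (answers e ! i) m)"
  using assms(2)
proof cases
  case (call_new m' B Bs fork)
  have "running t = running s - {#m'#} + image_mset fork (mset_set (clauses_for H (pred B)))"
    by (simp add: call_new(2))
  then consider "m \<in># running s" | c where "c \<in> clauses_for H (pred B)" "m = fork c"
    using assms(1,3) unfolding clauses_for_def by (auto dest: in_diffD)
  then show ?thesis
  proof cases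
    case (2 c)
    then have "rule_machine (pred B) c m" "table t (pred B) \<noteq> None"
      using call_new by auto
    with 2(1) show ?thesis
      by blast
  qed simp
next
  case (consume_success p e m' i m'')
  then have "m = m'' \<or> m \<in># running s"
    using assms(3) by auto
  then show ?thesis
    using consume_success by blast
qed (use assms(3) in \<open>auto dest: in_diffD\<close>)

lemma step_present:
  assumes "finite H" "step H oper s t" "present t m"
  shows "present s m \<or>
    (\<exists>p c. table t p \<noteq> None \<and> c \<in> clauses_for H p \<and> rule_machine p c m) \<or>
    (\<exists>p e m' i. table s p = Some e \<and> (m', i) \<in># suspended e \<and> i < length (answers e) \<and>
       resumes_with m' (answers e ! i) m)"
  using assms(3) step_waiting[OF assms(2)] step_running[OF assms(1,2)] unfolding present_def by metis

text \<open>The first conjunct lets a search for variants be confined to one entry, the second gives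
  \<open>hd\<close> and \<open>tl\<close> of a waiting body a meaning, and the third ties machines
  to resolvents. Its demand for an entry of the head predicate lets a finished machine return and
  excludes machines for \<open>c\<close> before the first call. Machines without origin are exempt,
  as they add no answers to the table.\<close>

definition consistent :: "('p, 'f) clause set \<Rightarrow> ('p, 'f) state \<Rightarrow> bool" where
  "consistent H s \<longleftrightarrow>
     (\<forall>p e A. table s p = Some e \<longrightarrow> A \<in> set (answers e) \<longrightarrow> pred A = p) \<and>
     (\<forall>p m i. waiting s p m i \<longrightarrow> body (form m) \<noteq> [] \<and> pred (hd (body (form m))) = p) \<and>
     (\<forall>m c. present s m \<longrightarrow> origin m = Some c \<longrightarrow> c \<in> H \<and> table s (pred (head c)) \<noteq> None \<and>
        (\<exists>As. set As \<subseteq> table_answers s \<and> resolvent c As (form m)))"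

lemma consistentD:
  assumes "consistent H s"
  shows "table s p = Some e \<Longrightarrow> A \<in> set (answers e) \<Longrightarrow> pred A = p"
    and "waiting s p m i \<Longrightarrow> body (form m) \<noteq> []"
    and "waiting s p m i \<Longrightarrow> pred (hd (body (form m))) = p"
    and "present s m \<Longrightarrow> origin m = Some c \<Longrightarrow> c \<in> H"
    and "present s m \<Longrightarrow> origin m = Some c \<Longrightarrow> table s (pred (head c)) \<noteq> None"
    and "present s m \<Longrightarrow> origin m = Some c \<Longrightarrow>
      \<exists>As. set As \<subseteq> table_answers s \<and> resolvent c As (form m)"
  using assms unfolding consistent_def by blast+

lemma consistent_initial: "consistent H (initial_state G)"
  by (auto simp: consistent_def initial_state_def present_def waiting_def)

lemma consistent_step:
  assumes "finite H" and step: "step H oper s t" and s: "consistent H s"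
  shows "consistent H t"
proof -
  have "pred A = p" if "table t p = Some e" "A \<in> set (answers e)" for p e A
    using step_answers[OF step that] consistentD(1)[OF s] by blast
  moreover have "body (form m) \<noteq> [] \<and> pred (hd (body (form m))) = p" if "waiting t p m i" for p m i
  proof -
    have "(\<exists>i. waiting s p m i) \<or> (\<exists>B Bs. body (form m) = B # Bs \<and> pred B = p)"
      using step_waiting[OF step that] by blast
    then show ?thesis
    proof (elim disjE exE conjE)
      fix i assume "waiting s p m i"
      then show ?thesis
        using consistentD(2,3)[OF s] by blast
    qed simp
  qed
  moreover have "c \<in> H \<and> table t (pred (head c)) \<noteq> None \<and>
      (\<exists>As. set As \<subseteq> table_answers t \<and> resolvent c As (form m))"
    if m: "present t m" and c: "origin m = Some c" for m c
    using step_present[OF assms(1) step m]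
  proof (elim disjE exE conjE)
    assume "present s m"
    then have "c \<in> H" "table s (pred (head c)) \<noteq> None"
      "\<exists>As. set As \<subseteq> table_answers s \<and> resolvent c As (form m)"
      using consistentD(4-6)[OF s] c by blast+
    then show ?thesis
      using step_table_mono[OF step] step_table_answers_mono[OF step] by blast
  next
    fix p c'
    assume c': "table t p \<noteq> None" "c' \<in> clauses_for H p" "rule_machine p c' m"
    then have "c' = c"
      using c rule_machine_origin by fastforce
    then show ?thesis
      using c' rule_machine_resolvent[of p c m]
      by (intro conjI exI[of _ "[]"]) (auto simp: clauses_for_def)
  next
    fix p e m' i
    assume m': "table s p = Some e" "(m', i) \<in># suspended e" "i < length (answers e)"
      "resumes_with m' (answers e ! i) m"
    then have w: "waiting s p m' i" and o: "origin m' = Some c"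
      using c resumes_with_origin[OF m'(4)] by (auto simp: waiting_def)
    then have pr: "present s m'"
      unfolding present_def by blast
    obtain As where As: "set As \<subseteq> table_answers s" "resolvent c As (form m')"
      using consistentD(6)[OF s pr o] by blast
    have "resolvent c (As @ [answers e ! i]) (form m)"
      using resolvent_resumes As(2) consistentD(2)[OF s w] m'(4) .
    moreover have "set (As @ [answers e ! i]) \<subseteq> table_answers t"
      using As(1) table_answersI[OF m'(1) nth_mem[OF m'(3)]] step_table_answers_mono[OF step] by auto
    ultimately show ?thesis
      using consistentD(4,5)[OF s pr o] step_table_mono[OF step] by blast
  qed
  ultimately show ?thesis
    unfolding consistent_def by blast
qed

lemma step_no_answer:
  assumes "step H oper s t" "\<And>m. oper = Return m \<Longrightarrow> origin m = None"
  shows "table_answers t = table_answers s"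
proof
  show "table_answers t \<subseteq> table_answers s"
    using assms by (cases rule: step.cases) (auto simp: table_answers_def split: if_splits)
qed (rule step_table_answers_mono[OF assms(1)])

lemma step_table_answers:
  assumes "step H oper s t" "consistent H s"
  shows "table_answers t =
    (case oper of
       Return m \<Rightarrow>
         if origin m \<noteq> None \<and> \<not> (\<exists>B\<in>table_answers s. variant (head (form m)) B)
         then insert (head (form m)) (table_answers s) else table_answers s
     | _ \<Rightarrow> table_answers s)"
  using assms(1)
proof cases
  case (return_answer m c A e)
  \<comment> \<open>\<open>add_answer\<close> looks only at the entry of \<open>A\<close>. Variants
    share their predicate, so this amounts to looking at the whole table.\<close>
  have iff: "(\<exists>B\<in>table_answers s. variant A B) \<longleftrightarrow> (\<exists>B\<in>set (answers e). variant A B)"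
  proof
    assume "\<exists>B\<in>table_answers s. variant A B"
    then obtain B p e' where B: "variant A B" "table s p = Some e'" "B \<in> set (answers e')"
      by (auto simp: table_answers_def)
    then have "p = pred A"
      using consistentD(1)[OF assms(2)] pred_variant by metis
    then show "\<exists>B\<in>set (answers e). variant A B"
      using B return_answer by auto
  qed (use table_answersI[OF return_answer(6)] in blast)
  have "B \<in> table_answers t \<longleftrightarrow> B \<in> table_answers s \<or> B \<in> set (add_answer A (answers e))" for B
  proof
    assume "B \<in> table_answers t"
    then show "B \<in> table_answers s \<or> B \<in> set (add_answer A (answers e))"
      using return_answer(6) by (auto simp: table_answers_def return_answer(2) split: if_splits)
  next
    assume "B \<in> table_answers s \<or> B \<in> set (add_answer A (answers e))"
    moreover have "B \<in> table_answers t" if "B \<in> set (add_answer A (answers e))"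
      using that by (intro table_answersI[of t "pred A"]) (auto simp: return_answer(2))
    ultimately show "B \<in> table_answers t"
      using step_table_answers_mono[OF assms(1)] by blast
  qed
  then have "table_answers t = table_answers s \<union> set (add_answer A (answers e))"
    by blast
  also have "\<dots> = (if \<exists>B\<in>table_answers s. variant A B then table_answers s
      else insert A (table_answers s))"
    using table_answersI[OF return_answer(6)] by (auto simp: iff set_add_answer)
  finally show ?thesis
    using return_answer by simp
qed (use step_no_answer[OF assms(1)] in auto)

section \<open>Arbitrary runs and their rule schedule\<close>

locale evaluation =
  fixes H :: "('p, 'f) clause set"
    and G :: "('p, 'f) atom"
    and s :: "nat \<Rightarrow> ('p, 'f) state"
    and sched :: "nat \<Rightarrow> ('p, 'f) operation option"
  assumes finite_program: "finite H"
    and run: "stwfa_run H G s sched"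
begin

lemma initial: "s 0 = initial_state G"
  using run by (simp add: stwfa_run_def)

lemma run_cases:
  obtains (idle) "sched n = None" "s (Suc n) = s n" "\<And>oper t. \<not> step H oper (s n) t"
  | (op) oper where "sched n = Some oper" "step H oper (s n) (s (Suc n))"
proof -
  have "case sched n of
        None \<Rightarrow> (\<nexists>oper t. step H oper (s n) t) \<and> s (Suc n) = s n
      | Some oper \<Rightarrow> step H oper (s n) (s (Suc n))"
    using run unfolding stwfa_run_def by blast
  then show ?thesis
    using that by (cases "sched n") auto
qed

lemma scheduled_step: "sched n = Some oper \<Longrightarrow> step H oper (s n) (s (Suc n))"
  by (cases n rule: run_cases) auto

lemma consistent: "consistent H (s n)"
proof (induction n)
  case 0
  then show ?case
    by (simp add: initial consistent_initial)
next
  case (Suc n)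
  then show ?case
    by (cases n rule: run_cases) (auto intro: consistent_step[OF finite_program])
qed

lemma table_mono:
  assumes "table (s n) p = Some e" "n \<le> k"
  shows "\<exists>e' as. table (s k) p = Some e' \<and> answers e' = answers e @ as"
  using assms(2)
proof (induction k rule: dec_induct)
  case base
  then show ?case
    using assms(1) by simp
next
  case (step k)
  then obtain e' as where e': "table (s k) p = Some e'" "answers e' = answers e @ as"
    by blast
  show ?case
  proof (cases k rule: run_cases)
    case idle
    then show ?thesis
      using e' by simp
  next
    case (op oper)
    then show ?thesis
      using step_table_mono[OF op(2) e'(1)] e'(2) by auto
  qed
qed

text \<open>Answers are only appended, so a position names the same answer at any two times at which
  it is filled. This identifies the answer that is actually consumed with the one seen at another
  time.\<close>

lemma answers_stable:
  assumes "table (s n) p = Some e" "table (s k) p = Some e'"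
    "i < length (answers e)" "i < length (answers e')"
  shows "answers e ! i = answers e' ! i"
proof -
  have "answers e ! i = answers e' ! i"
    if "n \<le> k" "table (s n) p = Some e" "table (s k) p = Some e'" "i < length (answers e)"
    for n k e e'
    using table_mono[OF that(2,1)] that(3,4) by (auto simp: nth_append)
  then show ?thesis
    using assms nat_le_linear[of n k] by metis
qed

lemma called_forks:
  assumes "table (s k) p \<noteq> None" "c \<in> clauses_for H p"
  obtains n m where "n < k" "forks_rule_machine s n c" "m \<in># running (s (Suc n))"
    "rule_machine p c m"
proof -
  have c: "pred (head c) = p"
    using assms(2) by (simp add: clauses_for_def)
  have "table (s 0) p = None"
    by (simp add: initial initial_state_def)
  then obtain n where n: "n < k" "table (s n) p = None" "table (s (Suc n)) p \<noteq> None"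
    using assms(1) ex_least_nat_less[of "\<lambda>k. table (s k) p \<noteq> None" k] by auto
  then obtain oper where "step H oper (s n) (s (Suc n))"
    by (cases n rule: run_cases) auto
  then obtain m fork where fork: "\<forall>c\<in>clauses_for H p. rule_machine p c (fork c)" and
    running: "running (s (Suc n)) =
      running (s n) - {#m#} + image_mset fork (mset_set (clauses_for H p))"
    using step_table_new n by metis
  have fin: "finite (clauses_for H p)"
    using finite_program by (simp add: clauses_for_def)
  \<comment> \<open>A machine for \<open>c\<close> presupposes an entry for its head predicate. That
    entry is still missing, so none is running before the call.\<close>
  have "{#m' \<in># running (s n) - {#m#}. origin m' = Some c#} = {#}"
  proof -
    have "origin m' \<noteq> Some c" if "m' \<in># running (s n)" for m'
      using consistentD(5)[OF consistent, of n m' c] that n(2) c by (auto simp: present_def)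
    then show ?thesis
      unfolding filter_mset_eq_mempty_iff by (blast dest: in_diffD)
  qed
  moreover have "{#m' \<in># image_mset fork (mset_set (clauses_for H p)). origin m' = Some c#}
    = {#fork c#}"
  proof -
    have "{#c' \<in># mset_set (clauses_for H p). origin (fork c') = Some c#}
      = mset_set {c' \<in> clauses_for H p. origin (fork c') = Some c}"
      using fin by simp
    \<comment> \<open>The origin records the clause itself, so machines forked for other clauses of
      the same predicate are not counted.\<close>
    also have "{c' \<in> clauses_for H p. origin (fork c') = Some c} = {c}"
      using fork assms(2) rule_machine_origin by fastforce
    finally show ?thesis
      by (simp add: filter_mset_image_mset)
  qed
  ultimately have "forks_rule_machine s n c"
    using n(2) c by (simp add: forks_rule_machine_def running)
  moreover have "fork c \<in># running (s (Suc n))"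
    using fin assms(2) by (simp add: running)
  ultimately show ?thesis
    using that n(1) fork assms(2) by blast
qed

lemma forks_rule_machine_called:
  assumes "forks_rule_machine s n c"
  shows "table (s (Suc n)) (pred (head c)) \<noteq> None"
proof -
  have "{#m \<in># running (s (Suc n)). origin m = Some c#} \<noteq> {#}"
    using assms unfolding forks_rule_machine_def by (metis size_empty zero_neq_one)
  then obtain m where "m \<in># running (s (Suc n))" "origin m = Some c"
    by auto
  then show ?thesis
    using consistentD(5)[OF consistent] by (auto simp: present_def)
qed

lemma forks_rule_machine_unique:
  assumes "forks_rule_machine s n c" "forks_rule_machine s k c"
  shows "n = k"
proof -
  have "\<not> n < k" if "forks_rule_machine s n c" "forks_rule_machine s k c" for n k
  proof
    assume "n < k"
    then have "table (s k) (pred (head c)) \<noteq> None"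
      using forks_rule_machine_called[OF that(1)] table_mono[of "Suc n" _ _ k] by fastforce
    then show False
      using that(2) by (simp add: forks_rule_machine_def)
  qed
  then show ?thesis
    using assms by (meson linorder_neqE_nat)
qed

lemma returns_new_answer_cases:
  assumes "returns_new_answer s sched n c A"
  obtains m As where "sched n = Some (Return m)" "origin m = Some c" "present (s n) m"
    "form m = Clause A []" "set As \<subseteq> table_answers (s n)" "resolvent c As (form m)"
    "\<not> (\<exists>B\<in>table_answers (s n). variant A B)"
proof -
  obtain m where m: "sched n = Some (Return m)" "origin m = Some c" "head (form m) = A"
    "\<not> (\<exists>B\<in>table_answers (s n). variant A B)"
    using assms by (auto simp: returns_new_answer_def)
  have "present (s n) m" "form m = Clause A []"
    using scheduled_step[OF m(1)] m(3) by (cases rule: step.cases; auto simp: present_def)+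
  moreover from this obtain As where "set As \<subseteq> table_answers (s n)" "resolvent c As (form m)"
    using consistentD(6)[OF consistent] m(2) by blast
  ultimately show ?thesis
    using that m by blast
qed

lemma returns_new_answer_insert:
  assumes "returns_new_answer s sched n c A"
  shows "table_answers (s (Suc n)) = insert A (table_answers (s n))"
proof -
  obtain m where "sched n = Some (Return m)" "origin m = Some c" "head (form m) = A"
    "\<not> (\<exists>B\<in>table_answers (s n). variant A B)"
    using assms by (auto simp: returns_new_answer_def)
  then show ?thesis
    using step_table_answers[OF scheduled_step consistent] by simp
qed

lemma no_new_answer:
  assumes "\<nexists>c A. returns_new_answer s sched n c A"
  shows "table_answers (s (Suc n)) = table_answers (s n)"
proof (cases n rule: run_cases)
  case (op oper)
  have "origin m = None \<or> (\<exists>B\<in>table_answers (s n). variant (head (form m)) B)"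
    if "oper = Return m" for m
    using assms op(1) that unfolding returns_new_answer_def by auto
  then show ?thesis
    using step_table_answers[OF op(2) consistent] by (auto split: operation.splits)
qed simp

lemma returns_new_answer_adds_fact:
  assumes "returns_new_answer s sched n c A"
  shows "c \<in> H" "adds_fact c (table_answers (s n)) A" "\<exists>k<n. forks_rule_machine s k c"
proof -
  obtain m As where m: "origin m = Some c" "present (s n) m" "form m = Clause A []"
    "set As \<subseteq> table_answers (s n)" "resolvent c As (form m)"
    "\<not> (\<exists>B\<in>table_answers (s n). variant A B)"
    using returns_new_answer_cases[OF assms] .
  then obtain \<sigma> where \<sigma>: "most_general_cover c As \<sigma>" "A = subst_atom \<sigma> (head c)"
    "length (body c) \<le> length As"
    by (auto simp: resolvent_def)
  \<comment> \<open>No body atom is left to call, so \<open>As\<close> is at least as long as the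
    body; covering gives the other bound.\<close>
  then have "length As = length (body c)"
    using covers_length unfolding most_general_cover_def by fastforce
  then have "most_general_supported c As \<sigma>"
    using most_general_cover_supported \<sigma>(1) by blast
  then show "adds_fact c (table_answers (s n)) A"
    using m(4,6) \<sigma>(2) unfolding adds_fact_def by blast
  show "c \<in> H"
    using consistentD(4)[OF consistent m(2,1)] .
  then show "\<exists>k<n. forks_rule_machine s k c"
    using called_forks[OF consistentD(5)[OF consistent m(2,1)]] by (auto simp: clauses_for_def)
qed

definition rule_schedule :: "nat \<Rightarrow> ('p, 'f) clause option" where
  "rule_schedule n = (if \<exists>c A. returns_new_answer s sched n c A
     then Some (SOME c. \<exists>A. returns_new_answer s sched n c A) else None)"

text \<open>At most one machine returns at a time and its origin determines the clause, so the
  choice in \<open>rule_schedule\<close> has a single candidate.\<close>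

lemma rule_schedule_iff: "rule_schedule n = Some c \<longleftrightarrow> (\<exists>A. returns_new_answer s sched n c A)"
proof -
  have unique: "c = c'" if "returns_new_answer s sched n c A" "returns_new_answer s sched n c' A'"
    for c A c' A'
    using that by (auto simp: returns_new_answer_def)
  show ?thesis
  proof (cases "\<exists>c A. returns_new_answer s sched n c A")
    case True
    then have "\<exists>A. returns_new_answer s sched n (SOME c. \<exists>A. returns_new_answer s sched n c A) A"
      by (rule someI_ex)
    then show ?thesis
      using True unique unfolding rule_schedule_def by auto
  qed (auto simp: rule_schedule_def)
qed

lemma bottom_up: "bottom_up_run H (\<lambda>n. table_answers (s n)) rule_schedule"
proof -
  have "case rule_schedule n of None \<Rightarrow> table_answers (s (Suc n)) = table_answers (s n)
      | Some c \<Rightarrow> c \<in> H \<and> (\<exists>A. adds_fact c (table_answers (s n)) A \<and>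
          table_answers (s (Suc n)) = insert A (table_answers (s n)))" for n
  proof (cases "rule_schedule n")
    case None
    then have "\<nexists>c A. returns_new_answer s sched n c A"
      using rule_schedule_iff by (metis option.distinct(1))
    then show ?thesis
      using no_new_answer None by simp
  next
    case (Some c)
    then obtain A where "returns_new_answer s sched n c A"
      using rule_schedule_iff by blast
    then show ?thesis
      using returns_new_answer_adds_fact(1,2) returns_new_answer_insert Some by fastforce
  qed
  moreover have "table_answers (s 0) = {}"
    by (simp add: initial initial_state_def table_answers_def)
  ultimately show ?thesis
    by (simp add: bottom_up_run_def)
qed

definition called :: "'p predicate \<Rightarrow> bool" where
  "called p \<longleftrightarrow> (\<exists>n. table (s n) p \<noteq> None)"

end

section \<open>Liveness and completeness of fair runs\<close>

locale fair_evaluation = evaluation H G s sched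
  for H :: "('p, 'f) clause set" and G s sched +
  assumes fair: "fair H s sched"
begin

text \<open>\<open>Q\<close> says that the operation is still outstanding, and only performing it
  can end \<open>Q\<close>. Were it never performed, \<open>Q\<close> would last forever, against
  fairness. The separate bound \<open>n'\<close> serves operations that may become possible later
  than \<open>Q\<close> starts to hold, such as consuming an answer that is yet to be added.\<close>

lemma eventually_scheduled:
  assumes "Q n" and enabled: "\<And>k. n' \<le> k \<Longrightarrow> Q k \<Longrightarrow> \<exists>t. step H oper (s k) t"
    and stable: "\<And>k. Q k \<Longrightarrow> sched k \<noteq> Some oper \<Longrightarrow> Q (Suc k)"
  obtains k where "Q k" "step H oper (s k) (s (Suc k))"
proof -
  have "\<exists>k. Q k \<and> sched k = Some oper"
  proof (rule ccontr)
    assume neg: "\<nexists>k. Q k \<and> sched k = Some oper"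
    have Q: "Q k" if "n \<le> k" for k
      using that by (induction k rule: dec_induct) (use assms(1) stable neg in blast)+
    then have "\<forall>k\<ge>max n n'. \<exists>t. step H oper (s k) t"
      using enabled by simp
    then obtain k where "k \<ge> max n n'" "sched k = Some oper"
      using fair unfolding fair_def by blast
    then show False
      using neg Q by simp
  qed
  then show ?thesis
    using that scheduled_step by blast
qed

lemma running_stable:
  assumes "m \<in># running (s k)" "sched k \<noteq> Some (Call m)" "sched k \<noteq> Some (Return m)"
  shows "m \<in># running (s (Suc k))"
proof (cases k rule: run_cases)
  case (op oper)
  then have "oper \<noteq> Call m" "oper \<noteq> Return m"
    using assms by auto
  with op(2) assms(1) show ?thesis
    by (cases rule: step.cases) (auto simp: in_diff_count)
qed (use assms(1) in simp)

lemma call_enabled: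
  assumes "m \<in># running (s k)" "body (form m) = B # Bs"
  shows "\<exists>t. step H (Call m) (s k) t"
proof (cases "table (s k) (pred B)")
  case None
  have "\<forall>c\<in>clauses_for H (pred B). \<exists>m. rule_machine (pred B) c m"
    using rule_machine_exists unfolding clauses_for_def by blast
  then obtain fork where "\<forall>c\<in>clauses_for H (pred B). rule_machine (pred B) c (fork c)"
    by metis
  then show ?thesis
    using call_new[of m "s k", OF assms None] by blast
next
  case (Some e)
  then show ?thesis
    using call_old[of m "s k", OF assms Some] by blast
qed

lemma eventually_waiting:
  assumes "m \<in># running (s n)" "body (form m) = B # Bs"
  shows "\<exists>k. waiting (s k) (pred B) m 0"
proof -
  let ?Q = "\<lambda>k. m \<in># running (s k)"
  have "sched k \<noteq> Some (Return m)" for k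
  proof
    assume "sched k = Some (Return m)"
    then show False
      using scheduled_step assms(2) by (fastforce elim: step.cases)
  qed
  then obtain k where "step H (Call m) (s k) (s (Suc k))"
    using eventually_scheduled[of ?Q n 0 "Call m"] assms(1) call_enabled[OF _ assms(2)]
      running_stable by metis
  then have "waiting (s (Suc k)) (pred B) m 0"
    using assms(2) by (cases rule: step.cases) (auto simp: waiting_def)
  then show ?thesis ..
qed

lemma eventually_returned:
  assumes m: "m \<in># running (s n)" "form m = Clause A []" "origin m = Some c"
  shows "\<exists>k. \<exists>B\<in>table_answers (s k). variant A B"
proof -
  let ?Q = "\<lambda>k. m \<in># running (s k)"
  have "\<exists>t. step H (Return m) (s k) t" if "?Q k" for k
  proof -
    have pr: "present (s k) m"
      using that by (simp add: present_def)
    then have "pred A = pred (head c)"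
      using consistentD(6)[OF consistent pr m(3)] resolvent_pred_head m(2) by fastforce
    then obtain e where "table (s k) (pred A) = Some e"
      using consistentD(5)[OF consistent pr m(3)] by auto
    then show ?thesis
      using return_answer[of m "s k"] that m by blast
  qed
  moreover have "sched k \<noteq> Some (Call m)" for k
  proof
    assume "sched k = Some (Call m)"
    then show False
      using scheduled_step m(2) by (fastforce elim: step.cases)
  qed
  ultimately obtain k where "step H (Return m) (s k) (s (Suc k))"
    using eventually_scheduled[of ?Q n 0 "Return m"] m(1) running_stable by metis
  then obtain e where "table (s (Suc k)) (pred A) = Some e" "\<exists>B\<in>set (answers e). variant A B"
  proof cases
    case (return_answer c' A' e)
    have "variant A A"
      unfolding variant_def renaming_def by (metis bij_id comp_id subst_atom_Var)
    then have "\<exists>B\<in>set (add_answer A (answers e)). variant A B"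
      by (auto simp: set_add_answer)
    then show ?thesis
      using that return_answer m by auto
  qed (use m in auto)
  then show ?thesis
    unfolding table_answers_def by blast
qed

lemma waiting_stable:
  assumes "waiting (s k) p m i" "sched k \<noteq> Some (Consume p m i)"
  shows "waiting (s (Suc k)) p m i"
proof (cases k rule: run_cases)
  case (op oper)
  then have "oper \<noteq> Consume p m i"
    using assms by auto
  with op(2) assms(1) show ?thesis
    by (cases rule: step.cases) (auto simp: waiting_def in_diff_count)
qed (use assms(1) in simp)

lemma eventually_consumed:
  assumes "waiting (s n) p m i" "table (s n') p = Some e" "i < length (answers e)"
  shows "\<exists>k. waiting (s k) p m (Suc i)"
    and "unifies_with_answer m (answers e ! i) \<Longrightarrow>
      \<exists>k m'. m' \<in># running (s k) \<and> resumes_with m (answers e ! i) m'"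
proof -
  let ?Q = "\<lambda>k. waiting (s k) p m i"
  have "\<exists>t. step H (Consume p m i) (s k) t" if k: "n' \<le> k" and Q: "?Q k" for k
  proof -
    obtain e' where e': "table (s k) p = Some e'" "(m, i) \<in># suspended e'"
      using Q by (auto simp: waiting_def)
    have i: "i < length (answers e')"
      using table_mono[OF assms(2) k] e'(1) assms(3) by auto
    show ?thesis
      using consume_success[of "s k", OF e' i] consume_failure[of "s k", OF e' i]
        resumes_with_exists by blast
  qed
  then obtain k where k: "step H (Consume p m i) (s k) (s (Suc k))"
    using eventually_scheduled[of ?Q n n' "Consume p m i"] assms(1) waiting_stable by metis
  then have "waiting (s (Suc k)) p m (Suc i)"
    by (cases rule: step.cases) (auto simp: waiting_def)
  then show "\<exists>k. waiting (s k) p m (Suc i)" ..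
  assume unif: "unifies_with_answer m (answers e ! i)"
  from k have "\<exists>m'. m' \<in># running (s (Suc k)) \<and> resumes_with m (answers e ! i) m'"
  proof cases
    case (consume_success e' m')
    then have "answers e' ! i = answers e ! i"
      using answers_stable assms(2,3) by blast
    then show ?thesis
      using consume_success by auto
  next
    case (consume_failure e')
    then have "answers e' ! i = answers e ! i"
      using answers_stable assms(2,3) by blast
    then show ?thesis
      using consume_failure unif by simp
  qed
  then show "\<exists>k m'. m' \<in># running (s k) \<and> resumes_with m (answers e ! i) m'"
    by blast
qed

lemma eventually_resumed:
  assumes m: "m \<in># running (s n)" "body (form m) = B # Bs"
    and A: "A \<in> table_answers (s n')" "pred A = pred B" "unifies_with_answer m A"
  shows "\<exists>k m'. m' \<in># running (s k) \<and> resumes_with m A m'"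
proof -
  obtain p e where "table (s n') p = Some e" "A \<in> set (answers e)"
    using A(1) by (auto simp: table_answers_def)
  then obtain i where e: "table (s n') (pred B) = Some e" "i < length (answers e)" "answers e ! i = A"
    using consistentD(1)[OF consistent] A(2) by (metis in_set_conv_nth)
  \<comment> \<open>Answers are consumed in order, so all those before position \<open>i\<close>
    have to be passed first. A failed unification advances the counter too, hence none of them
    blocks the machine.\<close>
  have "\<exists>k. waiting (s k) (pred B) m j" if "j \<le> i" for j
    using that
  proof (induction j)
    case 0
    then show ?case
      using eventually_waiting[OF m] by blast
  next
    case (Suc j)
    then show ?case
      using eventually_consumed(1)[OF _ e(1)] e(2) by (meson Suc_leD Suc_le_lessD less_trans)
  qed
  then show ?thesis
    using eventually_consumed(2)[OF _ e(1,2)] e(3) A(3) by blast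
qed

abbreviation all_answers :: "('p, 'f) atom set" where
  "all_answers \<equiv> \<Union>n. table_answers (s n)"

text \<open>A suspended machine stays and forks a copy for each answer, so every matching list of
  answers gets a branch of its own. \<open>\<tau>\<close> merely witnesses that the list can be
  matched, which keeps the branch from failing.\<close>

lemma resolvent_reached:
  assumes c: "called (pred (head c))" "c \<in> H"
  shows "covers c As \<tau> \<Longrightarrow> set As \<subseteq> all_answers \<Longrightarrow>
    \<exists>n m. m \<in># running (s n) \<and> origin m = Some c \<and> resolvent c As (form m)"
proof (induction As rule: rev_induct)
  case Nil
  obtain k where "table (s k) (pred (head c)) \<noteq> None"
    using c(1) by (auto simp: called_def)
  moreover have "c \<in> clauses_for H (pred (head c))"
    using c(2) by (simp add: clauses_for_def)
  ultimately show ?case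
    using called_forks rule_machine_resolvent rule_machine_origin by metis
next
  case (snoc A As)
  then obtain n m where m: "m \<in># running (s n)" "origin m = Some c" "resolvent c As (form m)"
    by (auto simp: covers_snoc)
  have cov: "length As < length (body c)" "instance_of (subst_atom \<tau> (body c ! length As)) A"
    using snoc.prems by (auto simp: covers_snoc)
  obtain B Bs where B: "body (form m) = B # Bs" "pred B = pred (body c ! length As)"
    using m(3) cov(1) by (auto simp: resolvent_def Cons_nth_drop_Suc[symmetric])
  have "pred A = pred B"
    using pred_instance_of[OF cov(2)] B(2) by simp
  moreover have "unifies_with_answer m A"
    using resolvent_unifies m(3) snoc.prems(1) by blast
  moreover obtain n' where "A \<in> table_answers (s n')"
    using snoc.prems(2) by auto
  ultimately obtain k m' where m': "m' \<in># running (s k)" "resumes_with m A m'"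
    using eventually_resumed[OF m(1) B(1)] by blast
  then have "resolvent c (As @ [A]) (form m')" "origin m' = Some c"
    using resolvent_resumes[OF m(3) _ m'(2)] B(1) resumes_with_origin[OF m'(2)] m(2) by auto
  then show ?case
    using m'(1) by blast
qed

lemma body_atom_called:
  assumes c: "called (pred (head c))" "c \<in> H"
    and As: "covers c As \<tau>" "set As \<subseteq> all_answers" "length As < length (body c)"
  shows "called (pred (body c ! length As))"
proof -
  obtain n m where m: "m \<in># running (s n)" "resolvent c As (form m)"
    using resolvent_reached[OF c As(1,2)] by blast
  obtain B Bs where B: "body (form m) = B # Bs" "pred B = pred (body c ! length As)"
    using m(2) As(3) by (auto simp: resolvent_def Cons_nth_drop_Suc[symmetric])
  show ?thesis
    using eventually_waiting[OF m(1) B(1)] B(2) by (auto simp: called_def waiting_def)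
qed

lemma supported_answer:
  assumes c: "called (pred (head c))" "c \<in> H"
    and As: "supported c As \<tau>" "set As \<subseteq> all_answers"
  obtains \<sigma> B where "most_general_supported c As \<sigma>" "B \<in> all_answers"
    "variant (subst_atom \<sigma> (head c)) B"
proof -
  have As': "covers c As \<tau>" "length As = length (body c)"
    using As(1) by (auto simp: supported_iff_covers)
  obtain n m where m: "m \<in># running (s n)" "origin m = Some c" "resolvent c As (form m)"
    using resolvent_reached[OF c As'(1) As(2)] by blast
  then obtain \<sigma> where \<sigma>: "most_general_cover c As \<sigma>" "form m = Clause (subst_atom \<sigma> (head c)) []"
    using As'(2) by (auto simp: resolvent_def)
  obtain k B where "B \<in> table_answers (s k)" "variant (subst_atom \<sigma> (head c)) B"
    using eventually_returned[OF m(1) \<sigma>(2) m(2)] by blast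
  then show ?thesis
    using that most_general_cover_supported[OF \<sigma>(1) As'(2)] by blast
qed

text \<open>Calls and answers advance together along the body: once the first \<open>j\<close> atoms
  are matched by answers, a machine calls the next one, and only then does \<open>body\<close>
  provide an answer for it. The premise \<open>called (pred B)\<close> makes the lemma usable before
  it is known which predicates get called.\<close>

lemma cover_by_answers:
  assumes c: "called (pred (head c))" "c \<in> H"
    and body: "\<And>B. B \<in> set (body c) \<Longrightarrow> called (pred B) \<Longrightarrow>
      \<exists>A\<in>all_answers. instance_of (subst_atom \<gamma> B) A"
    and "j \<le> length (body c)"
  shows "\<exists>As. length As = j \<and> covers c As \<gamma> \<and> set As \<subseteq> all_answers"
  using assms(4)
proof (induction j)
  case (Suc j)
  then obtain As where As: "length As = j" "covers c As \<gamma>" "set As \<subseteq> all_answers"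
    by auto
  have "called (pred (body c ! j))"
    using body_atom_called[OF c As(2,3)] As(1) Suc.prems by simp
  then obtain A where "A \<in> all_answers" "instance_of (subst_atom \<gamma> (body c ! j)) A"
    using body[of "body c ! j"] Suc.prems by auto
  then have "length (As @ [A]) = Suc j" "covers c (As @ [A]) \<gamma>" "set (As @ [A]) \<subseteq> all_answers"
    using As Suc.prems by (auto simp: covers_snoc)
  then show ?case
    by blast
qed auto

lemma least_model_answered:
  assumes H: "funs_program H \<subseteq> F"
  shows "A \<in> least_herbrand_model F H \<Longrightarrow> called (pred A) \<Longrightarrow> A \<in> ground_instances F all_answers"
proof -
  let ?I = "{A \<in> herbrand_base F. called (pred A) \<longrightarrow> A \<in> ground_instances F all_answers}"
  have "subst_atom \<gamma> (head c) \<in> ?I"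
    if c: "c \<in> H" and \<gamma>: "ground_subst F \<gamma>" "subst_atom \<gamma> ` set (body c) \<subseteq> ?I" for c \<gamma>
  proof -
    have base: "subst_atom \<gamma> (head c) \<in> herbrand_base F"
      using subst_in_herbrand_base[OF \<gamma>(1)] funs_atom_clause[OF H c] by blast
    moreover have "\<exists>B\<in>all_answers. instance_of (subst_atom \<gamma> (head c)) B"
      if head: "called (pred (head c))"
    proof -
      have "\<exists>A\<in>all_answers. instance_of (subst_atom \<gamma> B) A"
        if "B \<in> set (body c)" "called (pred B)" for B
      proof -
        have "subst_atom \<gamma> B \<in> ground_instances F all_answers"
          using \<gamma>(2) that by auto
        then show ?thesis
          by (auto simp: ground_instances_def)
      qed
      from cover_by_answers[OF head c this order_refl]
      obtain As where As: "length As = length (body c)" "covers c As \<gamma>" "set As \<subseteq> all_answers"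
        by blast
      then have supp: "supported c As \<gamma>"
        by (simp add: supported_iff_covers)
      obtain \<sigma> B where \<sigma>: "most_general_supported c As \<sigma>" and B: "B \<in> all_answers"
        "variant (subst_atom \<sigma> (head c)) B"
        using supported_answer[OF head c supp As(3)] .
      have "clause_instance_of (subst_clause \<gamma> c) (subst_clause \<sigma> c)"
        using \<sigma> supp unfolding most_general_supported_def by blast
      then obtain \<delta> where "subst_clause \<gamma> c = subst_clause \<delta> (subst_clause \<sigma> c)"
        unfolding clause_instance_of_def by blast
      then have "subst_atom \<gamma> (head c) = subst_atom \<delta> (subst_atom \<sigma> (head c))"
        by (metis subst_clause_simps(1))
      then have "instance_of (subst_atom \<gamma> (head c)) B"
        using instance_of_subst[OF variant_imp_instance_of[OF B(2)]] by simp
      then show ?thesis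
        using B(1) by blast
    qed
    ultimately show ?thesis
      by (auto simp: ground_instances_def)
  qed
  then have "herbrand_model F H ?I"
    unfolding herbrand_model_def by blast
  then have "least_herbrand_model F H \<subseteq> ?I"
    by (rule least_herbrand_model_subset)
  then show "A \<in> least_herbrand_model F H \<Longrightarrow> called (pred A) \<Longrightarrow> A \<in> ground_instances F all_answers"
    by blast
qed

lemma goal_called: "called (pred G)"
proof -
  have "Machine None (Clause G [G]) \<in># running (s 0)"
    by (simp add: initial initial_state_def)
  then show ?thesis
    using eventually_waiting[of "Machine None (Clause G [G])" 0 G "[]"]
    by (auto simp: called_def waiting_def)
qed

text \<open>A true instance of the body guarantees that no atom to the left of \<open>B\<close>
  blocks the machine: each is answered as soon as it is called, so some copy gets as far as
  \<open>B\<close>.\<close>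

lemma body_called:
  assumes H: "funs_program H \<subseteq> F" and c: "called (pred (head c))" "c \<in> H"
    and \<gamma>: "subst_atom \<gamma> ` set (body c) \<subseteq> least_herbrand_model F H"
    and B: "B \<in> set (body c)"
  shows "called (pred B)"
proof -
  obtain j where j: "j < length (body c)" "B = body c ! j"
    using B by (auto simp: in_set_conv_nth)
  have "\<exists>A\<in>all_answers. instance_of (subst_atom \<gamma> B) A"
    if "B \<in> set (body c)" "called (pred B)" for B
    using least_model_answered[OF H, of "subst_atom \<gamma> B"] \<gamma> that
    by (auto simp: ground_instances_def)
  from cover_by_answers[OF c this less_imp_le[OF j(1)]]
  obtain As where "length As = j" "covers c As \<gamma>" "set As \<subseteq> all_answers"
    by blast
  then show ?thesis
    using body_atom_called[OF c] j by blast
qed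

lemma reachable_called:
  assumes H: "funs_program H \<subseteq> F"
    and bodies_true: "\<forall>c\<in>H. \<exists>\<gamma>. subst_atom \<gamma> ` set (body c) \<subseteq> least_herbrand_model F H"
    and "(pred G, q) \<in> (call_graph H)\<^sup>*"
  shows "called q"
  using assms(3)
proof (induction rule: rtrancl_induct)
  case (step p q)
  then obtain c B where "c \<in> H" "pred (head c) = p" "B \<in> set (body c)" "pred B = q"
    by (auto simp: call_graph_def)
  with step.IH bodies_true show ?case
    using body_called[OF H] by metis
qed (rule goal_called)

lemma fixpoint:
  assumes "\<And>c. c \<in> H \<Longrightarrow> called (pred (head c))"
  shows "bottom_up_fixpoint H all_answers"
proof -
  have False if c: "c \<in> H" and "adds_fact c all_answers A" for c A
  proof -
    obtain As \<sigma> where As: "set As \<subseteq> all_answers" "most_general_supported c As \<sigma>"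
      and A: "A = subst_atom \<sigma> (head c)" "\<not> (\<exists>B\<in>all_answers. variant A B)"
      using \<open>adds_fact c all_answers A\<close> unfolding adds_fact_def by blast
    then have "supported c As \<sigma>"
      by (simp add: most_general_supported_def)
    then obtain \<sigma>' B where \<sigma>': "most_general_supported c As \<sigma>'" and
      B: "B \<in> all_answers" "variant (subst_atom \<sigma>' (head c)) B"
      using supported_answer[OF assms[OF c] c _ As(1)] by blast
    \<comment> \<open>Two most general substitutions for the same \<open>As\<close> yield heads that
      are instances of each other, hence variants. The rule process and the machine may choose
      differently and still agree on the fact.\<close>
    have "instance_of (subst_atom \<tau> (head c)) (subst_atom \<tau>' (head c))"
      if "most_general_supported c As \<tau>" "most_general_supported c As \<tau>'" for \<tau> \<tau>'
    proof -
      have "clause_instance_of (subst_clause \<tau> c) (subst_clause \<tau>' c)"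
        using that by (auto simp: most_general_supported_def)
      then show ?thesis
        unfolding clause_instance_of_def instance_of_def by (metis subst_clause_simps(1))
    qed
    then have "variant A (subst_atom \<sigma>' (head c))"
      unfolding A(1) using As(2) \<sigma>' by (intro instance_of_antisym)
    then show False
      using A(2) B variant_trans by blast
  qed
  then show ?thesis
    unfolding bottom_up_fixpoint_def by blast
qed

end

theorem theorem1:
  fixes H :: "('p, 'f) clause set"
    and F :: "('f \<times> nat) set"
    and P :: "'p predicate"
    and G :: "('p, 'f) atom"
    and s :: "nat \<Rightarrow> ('p, 'f) state"
    and sched :: "nat \<Rightarrow> ('p, 'f) operation option"
  assumes finite_H: "finite H"
    and signature: "funs_program H \<subseteq> F" "\<exists>a. (a, 0) \<in> F"
    and P_in_H: "P \<in> preds H"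
    and reachable: "\<forall>q \<in> preds H. (P, q) \<in> (call_graph H)\<^sup>*"
    and bodies_true: "\<forall>c \<in> H. \<exists>\<gamma>. ground_subst F \<gamma> \<and>
          subst_atom \<gamma> ` set (body c) \<subseteq> least_herbrand_model F H"
    and goal: "pred G = P"
    and run: "stwfa_run H G s sched"
  shows "\<exists>r. bottom_up_run H (\<lambda>n. table_answers (s n)) r \<and>
      ground_bottom_up_run F H (\<lambda>n. ground_instances F (table_answers (s n))) r \<and>
      (\<forall>n c. r n = Some c \<longleftrightarrow> (\<exists>A. returns_new_answer s sched n c A)) \<and>
      (\<forall>n c A. returns_new_answer s sched n c A \<longrightarrow>
         table_answers (s (Suc n)) = insert A (table_answers (s n))) \<and>
      (\<forall>k c. r k = Some c \<longrightarrow> (\<exists>n<k. forks_rule_machine s n c)) \<and>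
      (fair H s sched \<longrightarrow>
         (\<forall>c\<in>H. \<exists>!n. forks_rule_machine s n c) \<and>
         bottom_up_fixpoint H (\<Union>n. table_answers (s n)) \<and>
         ground_instances F (\<Union>n. table_answers (s n)) = least_herbrand_model F H)"
proof -
  interpret evaluation H G s sched
    using finite_H run by unfold_locales
  obtain a where a: "(a, 0) \<in> F"
    using signature(2) by blast
  have ground: "ground_bottom_up_run F H (\<lambda>n. ground_instances F (table_answers (s n))) rule_schedule"
    using ground_bottom_up_run_if_bottom_up_run[OF bottom_up signature(1) a] .
  have "(\<forall>c\<in>H. \<exists>!n. forks_rule_machine s n c) \<and>
         bottom_up_fixpoint H (\<Union>n. table_answers (s n)) \<and>
         ground_instances F (\<Union>n. table_answers (s n)) = least_herbrand_model F H"
    if "fair H s sched"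
  proof -
    interpret fair_evaluation H G s sched
      using that by unfold_locales
    have called: "called (pred (head c))" if "c \<in> H" for c
    proof (rule reachable_called[OF signature(1)])
      show "(pred G, pred (head c)) \<in> (call_graph H)\<^sup>*"
        using reachable goal that by (auto simp: preds_def)
    qed (use bodies_true in blast)
    have "\<exists>!n. forks_rule_machine s n c" if "c \<in> H" for c
    proof -
      obtain k where "table (s k) (pred (head c)) \<noteq> None"
        using called[OF \<open>c \<in> H\<close>] unfolding called_def by blast
      then obtain n where "forks_rule_machine s n c"
        using called_forks[of k "pred (head c)" c] \<open>c \<in> H\<close> by (auto simp: clauses_for_def)
      then show ?thesis
        using forks_rule_machine_unique by blast
    qed
    moreover have "ground_instances F all_answers \<subseteq> least_herbrand_model F H"
    proof -
      have "ground_instances F all_answers = (\<Union>n. ground_instances F (table_answers (s n)))"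
        by (auto simp: ground_instances_def)
      then show ?thesis
        using ground_bottom_up_run_sound[OF ground signature(1)] by auto
    qed
    moreover have "least_herbrand_model F H \<subseteq> ground_instances F all_answers"
    proof
      fix A assume A: "A \<in> least_herbrand_model F H"
      \<comment> \<open>Calls are known for predicates of clause heads. Restricting the least model
        to these predicates leaves a model, so the least model contains no other atoms.\<close>
      let ?I = "{A. \<exists>c\<in>H. pred A = pred (head c)} \<inter> least_herbrand_model F H"
      have "herbrand_model F H ?I"
        using herbrand_model_least[OF signature(1)] unfolding herbrand_model_def by fastforce
      then have "A \<in> ?I"
        using A least_herbrand_model_subset by blast
      then show "A \<in> ground_instances F all_answers"
        using least_model_answered[OF signature(1) A] called by auto
    qed
    ultimately show ?thesis
      using fixpoint[OF called] by blast
  qed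
  then show ?thesis
    using bottom_up ground rule_schedule_iff returns_new_answer_insert returns_new_answer_adds_fact(3)
    by (intro exI[of _ rule_schedule]) blast
qed

end
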